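(* Let $R=(a_h)_{h\ge1}$ be an $\infty$-folding sequence and let $S=(s_h)_{h\in\mathbb{Z}}$ be defined by $s_h=a_h$ and $s_{-h}=-a_h$ for $h\ge1$, and $s_0=\varepsilon$ for some fixed $\varepsilon\in\{+1,-1\}$ (i.e. $S=(\overline{R},\varepsilon,R)$). Let $C$ be a complete curve with associated sequence $S$, and let $\mathcal{C}$ be a covering of $\mathbb{R}^2$ by complete folding curves which contains $C$ and satisfies the local isomorphism property. (1) If the set $\{n\in\mathbb{N}: a_{2^n}=(-1)^n\}$ is finite or cofinite, then $\mathcal{C}$ consists of exactly $2$ curves whose associated sequences are $S$ (up to a shift of indices) and $4$ other curves. (2) Otherwise, $\mathcal{C}$ consists of exactly $2$ curves, both with associated sequence $S$ (up to a shift of indices).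
   Context: All sequences take values in $\{+1,-1\}$. For $S=(a_1,\dots,a_n)$ write $\overline{S}=(-a_n,\dots,-a_1)$. The $n$-folding sequences are defined recursively: the only $0$-folding sequence is the empty sequence, and the $(n+1)$-folding sequences are exactly $(\overline{S},+1,S)$ and $(\overline{S},-1,S)$ with $S$ an $n$-folding sequence. An $\infty$-folding sequence is a sequence $(a_k)_{k\ge1}$ such that $(a_1,\dots,a_{2^n-1})$ is an $n$-folding sequence for every $n\ge1$. A subword of a sequence $(b_k)$ is a block $(b_{h+1},\dots,b_{h+m})$. A complete folding sequence is a sequence $(a_k)_{k\in\mathbb{Z}}$ each finite subword of which is a subword of some $n$-folding sequence. A segment is an oriented unit edge of $\mathbb{Z}^2$. A complete curve is a sequence $(C_i)_{i\in\mathbb{Z}}$ of segments such that the terminal point of $C_i$ is the initial point of $C_{i+1}$, consecutive supports are perpendicular, and all supports are pairwise distinct (curves differing by an index shift are identified). Its associated sequence is $(\eta_i)_{i\in\mathbb{Z}}$ with $\eta_i=+1$ (resp. $-1$) if one turns left (resp. right) from $C_i$ to $C_{i+1}$. A complete folding curve is a complete curve whose associated sequence is a complete folding sequence. A covering of $\mathbb{R}^2$ by complete folding curves is a set $\mathcal{C}$ of complete folding curves such that every unit edge of $\mathbb{Z}^2$ is the support of exactly one segment of exactly one curve of $\mathcal{C}$. A decorated segment of $\mathcal{C}$ is a segment of a curve of $\mathcal{C}$ together with, at each endpoint, the support of the segment of the same curve which precedes/follows it there. $\mathcal{C}$ satisfies the local isomorphism property if for every finite set $F$ of decorated segments of $\mathcal{C}$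 there is $r>0$ such that every disk of radius $r$ contains a translate $v+F$ ($v\in\mathbb{Z}^2$) which is a set of decorated segments of $\mathcal{C}$. *)

theory Defs
  imports "HOL-Analysis.Analysis" "HOL-Library.Sublist"
begin

definition bar :: "int list \<Rightarrow> int list" where
  "bar S = map uminus (rev S)"

inductive folding :: "nat \<Rightarrow> int list \<Rightarrow> bool" where
  folding_0: "folding 0 []"
| folding_Suc: "folding n S \<Longrightarrow> e \<in> {1, -1} \<Longrightarrow> folding (Suc n) (bar S @ [e] @ S)"

(* Indexed from 1; the value a 0 is irrelevant. *)
definition infinite_folding_seq :: "(nat \<Rightarrow> int) \<Rightarrow> bool" where
  "infinite_folding_seq a \<longleftrightarrow> (\<forall>n\<ge>1. folding n (map a [1..<2 ^ n]))"

definition complete_folding_seq :: "(int \<Rightarrow> int) \<Rightarrow> bool" where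
  "complete_folding_seq s \<longleftrightarrow>
     (\<forall>(h::int) (m::nat). \<exists>n T. folding n T \<and> sublist (map s [h + 1..h + int m]) T)"

definition two_sided :: "(nat \<Rightarrow> int) \<Rightarrow> int \<Rightarrow> int \<Rightarrow> int" where
  "two_sided a e h = (if h > 0 then a (nat h) else if h = 0 then e else - a (nat (- h)))"

type_synonym point = "int \<times> int"
type_synonym segment = "point \<times> point" \<comment> \<open>initial point, terminal point\<close>
type_synonym edge = "point set" \<comment> \<open>the set of the two endpoints\<close>

definition dir :: "segment \<Rightarrow> point" where
  "dir c = snd c - fst c"

definition is_segment :: "segment \<Rightarrow> bool" where
  "is_segment c \<longleftrightarrow> \<bar>fst (dir c)\<bar> + \<bar>snd (dir c)\<bar> = 1"

definition support :: "segment \<Rightarrow> edge" where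
  "support c = {fst c, snd c}"

definition unit_edges :: "edge set" where
  "unit_edges = support ` {c. is_segment c}"

definition perp :: "point \<Rightarrow> point \<Rightarrow> bool" where
  "perp u v \<longleftrightarrow> fst u * fst v + snd u * snd v = 0"

definition cross :: "point \<Rightarrow> point \<Rightarrow> int" where
  "cross u v = fst u * snd v - snd u * fst v"

definition complete_curve :: "(int \<Rightarrow> segment) \<Rightarrow> bool" where
  "complete_curve C \<longleftrightarrow>
     (\<forall>i. is_segment (C i)) \<and>
     (\<forall>i. snd (C i) = fst (C (i + 1))) \<and>
     (\<forall>i. perp (dir (C i)) (dir (C (i + 1)))) \<and>
     inj (\<lambda>i. support (C i))"

definition turns :: "(int \<Rightarrow> segment) \<Rightarrow> int \<Rightarrow> int" where
  "turns C i = (if cross (dir (C i)) (dir (C (i + 1))) > 0 then 1 else -1)"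

definition shift_rel :: "((int \<Rightarrow> segment) \<times> (int \<Rightarrow> segment)) set" where
  "shift_rel = {(C, D). \<exists>k. D = (\<lambda>i. C (i + k))}"

(* Curves are identified up to a shift of indices, so a member of a covering is a
   shift class; the parametrized curves in the class are its elements. *)
type_synonym curve = "(int \<Rightarrow> segment) set"

definition curve_of :: "(int \<Rightarrow> segment) \<Rightarrow> curve" where
  "curve_of C = shift_rel `` {C}"

definition complete_folding_curves :: "curve set" where
  "complete_folding_curves =
     {C. complete_curve C \<and> complete_folding_seq (turns C)} // shift_rel"

definition has_assoc_seq :: "curve \<Rightarrow> (int \<Rightarrow> int) \<Rightarrow> bool" where
  "has_assoc_seq K s \<longleftrightarrow> (\<exists>C\<in>K. turns C = s)"

definition segments_of :: "curve \<Rightarrow> segment set" where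
  "segments_of K = (\<Union>C\<in>K. range C)"

definition folding_covering :: "curve set \<Rightarrow> bool" where
  "folding_covering \<C> \<longleftrightarrow>
     \<C> \<subseteq> complete_folding_curves \<and>
     (\<forall>e\<in>unit_edges. \<exists>!(K, c). K \<in> \<C> \<and> c \<in> segments_of K \<and> support c = e)"

(* A segment with the support of its predecessor (at the initial point) and the
   support of its successor (at the terminal point). *)
type_synonym decorated_segment = "segment \<times> edge \<times> edge"

definition decorated_segments :: "curve set \<Rightarrow> decorated_segment set" where
  "decorated_segments \<C> =
     {(C i, support (C (i - 1)), support (C (i + 1))) | C i. C \<in> \<Union>\<C>}"

definition translate :: "point \<Rightarrow> decorated_segment \<Rightarrow> decorated_segment" where
  "translate v = (\<lambda>((p, q), e, f). ((v + p, v + q), (+) v ` e, (+) v ` f))"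

definition edge_points :: "edge \<Rightarrow> (real \<times> real) set" where
  "edge_points e = convex hull ((\<lambda>(x, y). (real_of_int x, real_of_int y)) ` e)"

definition decorated_points :: "decorated_segment \<Rightarrow> (real \<times> real) set" where
  "decorated_points = (\<lambda>(c, e, f). edge_points (support c) \<union> edge_points e \<union> edge_points f)"

definition local_isomorphism :: "curve set \<Rightarrow> bool" where
  "local_isomorphism \<C> \<longleftrightarrow>
     (\<forall>F. finite F \<and> F \<subseteq> decorated_segments \<C> \<longrightarrow>
       (\<exists>r>0. \<forall>z. \<exists>v. translate v ` F \<subseteq> decorated_segments \<C> \<and>
                      (\<Union>d\<in>translate v ` F. decorated_points d) \<subseteq> cball z r))"

end

theory Submission
  imports Defs
begin

text \<open>Identify the plane with the Gaussian integers so that the middle vertex of \<open>C\<close> is 0. Erasing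
  every second vertex of a folding curve gives a folding curve on the lattice generated by
  \<open>1 \<plusminus> i\<close>, so that every edge has a parent on the coarser lattice. Under repeated passage to
  parents, with rescaling, every edge falls into the square \<open>[-1, 1]\<^sup>2\<close>, whose twelve edges form a
  finite automaton driven by the letters \<open>a (2 ^ n)\<close>: the four edges at 0 are fixed, and the eight
  others are mapped to them, except that four survive when the letters alternate forever. Two edges
  belong to the same curve if and only if their ancestors finally agree or are joined at 0, whence
  two curves through 0 and none or four others.

  The same contraction shows that \<open>C\<close> alone covers arbitrarily large disks. By the local isomorphism
  property every finite part of the covering is therefore found inside \<open>C\<close>, which forces all curves
  to be oriented and to turn as the hierarchical structure of \<open>C\<close> prescribes.\<close>

subsection \<open>Gaussian integers\<close>

abbreviation is_sign :: "int \<Rightarrow> bool" where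
  "is_sign c \<equiv> c = 1 \<or> c = -1"

definition parity_sign :: "int \<Rightarrow> int" where
  "parity_sign k = (if even k then 1 else -1)"

lemma is_sign_parity_sign: "is_sign (parity_sign k)"
  by (simp add: parity_sign_def)

lemma parity_sign_nonzero [simp]: "parity_sign k \<noteq> 0"
  by (simp add: parity_sign_def)

lemma parity_sign_cong: "even (j - k) \<Longrightarrow> parity_sign j = parity_sign k"
  by (auto simp: parity_sign_def)

lemma parity_sign_add_1 [simp]: "parity_sign (k + 1) = - parity_sign k"
  by (simp add: parity_sign_def)

fun gmult :: "point \<Rightarrow> point \<Rightarrow> point" (infixl \<open>\<odot>\<close> 70) where
  "(a, b) \<odot> (c, d) = (a * c - b * d, a * d + b * c)"

lemma gmult_commute: "p \<odot> q = q \<odot> p"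
  by (cases p; cases q) simp

lemma gmult_assoc: "p \<odot> q \<odot> r = p \<odot> (q \<odot> r)"
  by (cases p; cases q; cases r) (simp add: algebra_simps)

lemma gmult_add_right: "p \<odot> (q + r) = p \<odot> q + p \<odot> r"
  by (cases p; cases q; cases r) (simp add: algebra_simps)

lemma gmult_diff_right: "p \<odot> (q - r) = p \<odot> q - p \<odot> r"
  by (cases p; cases q; cases r) (simp add: algebra_simps)

lemma gmult_minus_right: "p \<odot> (- q) = - (p \<odot> q)"
  by (cases p; cases q) simp

lemma gmult_0_right [simp]: "p \<odot> 0 = 0"
  by (cases p) (simp add: zero_prod_def)

lemma gmult_1_left [simp]: "(1, 0) \<odot> p = p"
  by (cases p) simp

definition sqnorm :: "point \<Rightarrow> int" where
  "sqnorm p = (fst p)\<^sup>2 + (snd p)\<^sup>2"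

lemma sqnorm_gmult: "sqnorm (p \<odot> q) = sqnorm p * sqnorm q"
  by (cases p; cases q) (simp add: sqnorm_def power2_eq_square algebra_simps)

lemma sqnorm_0 [simp]: "sqnorm 0 = 0"
  by (simp add: sqnorm_def)

lemma sqnorm_minus [simp]: "sqnorm (- p) = sqnorm p"
  by (simp add: sqnorm_def)

lemma sqnorm_nonneg [simp]: "sqnorm p \<ge> 0"
  by (simp add: sqnorm_def)

lemma sqnorm_eq_0_iff [simp]: "sqnorm p = 0 \<longleftrightarrow> p = 0"
  by (simp add: sqnorm_def prod_eq_iff)

lemma sqnorm_pos: "p \<noteq> 0 \<Longrightarrow> sqnorm p > 0"
  using sqnorm_nonneg[of p] by (simp add: less_le)

lemma sqnorm_parallelogram: "sqnorm (p + q) + sqnorm (p - q) = 2 * sqnorm p + 2 * sqnorm q"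
  by (simp add: sqnorm_def power2_eq_square algebra_simps)

lemma gmult_eq_0_iff: "p \<odot> q = 0 \<longleftrightarrow> p = 0 \<or> q = 0"
  using sqnorm_gmult[of p q] by (metis mult_eq_0_iff sqnorm_eq_0_iff)

lemma gmult_left_cancel: "p \<noteq> 0 \<Longrightarrow> p \<odot> q = p \<odot> r \<longleftrightarrow> q = r"
  using gmult_eq_0_iff[of p "q - r"] by (simp add: gmult_diff_right)

lemma one_plus_eq_0_iff [simp]: "(1, c) \<odot> p = 0 \<longleftrightarrow> p = 0"
  by (simp add: gmult_eq_0_iff) (simp add: zero_prod_def)

fun gconj :: "point \<Rightarrow> point" where
  "gconj (a, b) = (a, - b)"

lemma gmult_gconj: "p \<odot> gconj p = (sqnorm p, 0)"
  by (cases p) (simp add: sqnorm_def power2_eq_square)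

lemma gconj_gmult: "gconj p \<odot> q = (fst p * fst q + snd p * snd q, cross p q)"
  by (cases p; cases q) (simp add: cross_def)

lemma gmult_eq_if_perp:
  assumes "sqnorm p = 1" "perp p q"
  shows "q = (0, cross p q) \<odot> p"
proof -
  have "(0, cross p q) \<odot> p = (p \<odot> gconj p) \<odot> q"
    using assms(2) gconj_gmult[of p q]
    by (simp only: gmult_assoc gmult_commute[of _ p] perp_def)
  then show ?thesis by (simp add: gmult_gconj assms(1))
qed

lemma cross_gmult_rotate: "cross p ((0, t) \<odot> p) = t * sqnorm p"
  by (cases p) (simp add: cross_def sqnorm_def power2_eq_square algebra_simps)

fun even_point :: "point \<Rightarrow> bool" where
  "even_point (x, y) \<longleftrightarrow> even (x + y)"

lemma even_point_0 [simp]: "even_point 0"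
  by (simp add: zero_prod_def)

lemma even_point_add [simp]: "even_point (p + q) \<longleftrightarrow> (even_point p \<longleftrightarrow> even_point q)"
  by (cases p; cases q) auto

lemma even_point_minus [simp]: "even_point (- p) \<longleftrightarrow> even_point p"
  by (cases p) auto

lemma even_point_diff [simp]: "even_point (p - q) \<longleftrightarrow> (even_point p \<longleftrightarrow> even_point q)"
  by (cases p; cases q) auto

lemma even_point_iff_sqnorm: "even_point p \<longleftrightarrow> even (sqnorm p)"
  by (cases p) (auto simp: sqnorm_def)

lemma even_snd_gmult: "is_sign c \<Longrightarrow> even (snd ((1, c) \<odot> p)) \<longleftrightarrow> even_point p"
  by (cases p) auto

lemma sqnorm_one_plus: "is_sign c \<Longrightarrow> sqnorm ((1, c) \<odot> p) = 2 * sqnorm p"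
  by (auto simp: sqnorm_gmult) (simp_all add: sqnorm_def)

lemma even_point_one_plus [simp]: "is_sign c \<Longrightarrow> even_point ((1, c) \<odot> p)"
  by (simp add: even_point_iff_sqnorm sqnorm_one_plus)

text \<open>Division by \<open>1 + c i\<close>, meaningful for even points only.\<close>

fun contract :: "int \<Rightarrow> point \<Rightarrow> point" where
  "contract c (x, y) = ((x + c * y) div 2, (y - c * x) div 2)"

lemma contract_gmult_add:
  assumes "is_sign c"
  shows "contract c ((1, c) \<odot> p + q) = p + contract c q"
proof -
  obtain u v x y where pq: "p = (u, v)" "q = (x, y)" by (cases p; cases q)
  have "(u - c * v + x + c * (v + c * u + y)) div 2 = (2 * u + (x + c * y)) div 2"
    "(v + c * u + y - c * (u - c * v + x)) div 2 = (2 * v + (y - c * x)) div 2"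
    using assms by (elim disjE; simp add: algebra_simps)+
  then show ?thesis unfolding pq by simp
qed

lemma contract_gmult [simp]: "is_sign c \<Longrightarrow> contract c ((1, c) \<odot> p) = p"
  using contract_gmult_add[of c p 0] by (cases "(1, c) \<odot> p") (simp add: zero_prod_def)

lemma gmult_contract:
  assumes "is_sign c" "even_point p"
  shows "(1, c) \<odot> contract c p = p"
proof -
  obtain x y where p: "p = (x, y)" by (cases p)
  then have "even (x + c * y)" "even (y - c * x)" using assms by auto
  then obtain u v where "x + c * y = 2 * u" "y - c * x = 2 * v" by (elim evenE)
  with assms(1) show ?thesis by (auto simp: p)
qed

lemma sqnorm_halved_less:
  assumes "2 * s = sqnorm (p + d)" "sqnorm d = 1" "sqnorm p > 5"
  shows "s < sqnorm p"
proof (rule ccontr)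
  assume "\<not> s < sqnorm p"
  then have "sqnorm (p - d) \<le> 2"
    using assms(1,2) sqnorm_parallelogram[of p d] by simp
  moreover have "sqnorm p + sqnorm (p - d - d) = 2 * sqnorm (p - d) + 2"
    using sqnorm_parallelogram[of "p - d" d] assms(2) by simp
  ultimately have "sqnorm p = 6" "sqnorm (p - d - d) = 0"
    using assms(3) sqnorm_nonneg[of "p - d - d"] by linarith+
  then have "p = d + d" by (simp add: algebra_simps)
  then show False
    using sqnorm_parallelogram[of d d] assms(2) \<open>sqnorm p = 6\<close> by simp
qed

subsection \<open>Oriented edges\<close>

definition turn_by :: "int \<Rightarrow> segment \<Rightarrow> segment" where
  "turn_by t c = (snd c, snd c + (0, t) \<odot> dir c)"

lemma fst_turn_by [simp]: "fst (turn_by t c) = snd c"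
  by (simp add: turn_by_def)

lemma snd_turn_by: "snd (turn_by t c) = snd c + (0, t) \<odot> dir c"
  by (simp add: turn_by_def)

lemma dir_turn_by [simp]: "dir (turn_by t c) = (0, t) \<odot> dir c"
  by (simp add: turn_by_def dir_def)

lemma is_segment_iff_sqnorm: "is_segment c \<longleftrightarrow> sqnorm (dir c) = 1"
proof -
  obtain x y where xy: "dir c = (x, y)" by (cases "dir c")
  have "\<bar>x\<bar> + \<bar>y\<bar> = 1 \<longleftrightarrow> x\<^sup>2 + y\<^sup>2 = 1"
  proof
    assume "\<bar>x\<bar> + \<bar>y\<bar> = 1"
    then have "\<bar>x\<bar> = 0 \<and> \<bar>y\<bar> = 1 \<or> \<bar>x\<bar> = 1 \<and> \<bar>y\<bar> = 0" by linarith
    then show "x\<^sup>2 + y\<^sup>2 = 1" by (metis power2_abs add_0 add_0_right one_power2 zero_power2)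
  next
    assume sum: "x\<^sup>2 + y\<^sup>2 = 1"
    then have "x\<^sup>2 \<le> 1" "y\<^sup>2 \<le> 1"
      using zero_le_power2[of x] zero_le_power2[of y] by linarith+
    then have "\<bar>x\<bar> \<le> 1" "\<bar>y\<bar> \<le> 1" by (simp_all add: abs_square_le_1)
    then have "x = -1 \<or> x = 0 \<or> x = 1" "y = -1 \<or> y = 0 \<or> y = 1" by linarith+
    with sum show "\<bar>x\<bar> + \<bar>y\<bar> = 1" by auto
  qed
  then show ?thesis by (simp add: is_segment_def sqnorm_def xy)
qed

lemma is_segment_turn_by: "is_sign t \<Longrightarrow> is_segment (turn_by t c) \<longleftrightarrow> is_segment c"
  by (auto simp: is_segment_iff_sqnorm sqnorm_gmult) (auto simp: sqnorm_def)

lemma turn_by_inject: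
  assumes "is_sign t" "turn_by t c = turn_by t c'"
  shows "c = c'"
proof -
  have "snd c = snd c'" "(0, t) \<odot> dir c = (0, t) \<odot> dir c'"
    using assms(2) by (auto simp: turn_by_def)
  moreover have "(0, t) \<noteq> (0 :: point)" using assms(1) by (auto simp: zero_prod_def)
  ultimately have "dir c = dir c'" by (simp add: gmult_left_cancel)
  with \<open>snd c = snd c'\<close> show ?thesis by (simp add: dir_def prod_eq_iff)
qed

lemma is_sign_turns: "is_sign (turns C i)"
  by (simp add: turns_def)

lemma turns_eqI:
  assumes "C (i + 1) = turn_by t (C i)" "is_segment (C i)" "is_sign t"
  shows "turns C i = t"
  using assms by (auto simp: turns_def cross_gmult_rotate is_segment_iff_sqnorm)

lemma complete_curve_turn_by:
  assumes "complete_curve C"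
  shows "C (i + 1) = turn_by (turns C i) (C i)"
proof -
  let ?t = "cross (dir (C i)) (dir (C (i + 1)))"
  have unit: "sqnorm (dir (C j)) = 1" for j
    using assms by (simp add: complete_curve_def is_segment_iff_sqnorm)
  have dir: "dir (C (i + 1)) = (0, ?t) \<odot> dir (C i)"
    using assms unit by (intro gmult_eq_if_perp) (auto simp: complete_curve_def)
  have "sqnorm (dir (C (i + 1))) = ?t\<^sup>2 * sqnorm (dir (C i))"
    by (subst dir) (simp add: sqnorm_gmult sqnorm_def[of "(0, _)"])
  then have "?t\<^sup>2 = 1" using unit by simp
  then have "turns C i = ?t" by (auto simp: turns_def power2_eq_1_iff)
  moreover have "fst (C (i + 1)) = snd (C i)" using assms by (simp add: complete_curve_def)
  moreover have "C (i + 1) = (fst (C (i + 1)), fst (C (i + 1)) + dir (C (i + 1)))"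
    by (simp add: dir_def)
  ultimately show ?thesis using dir by (simp add: turn_by_def)
qed

text \<open>All segments of a curve that turns by a right angle at each vertex satisfy this condition if
  one of them does. It selects one orientation of each edge.\<close>

definition is_arrow :: "segment \<Rightarrow> bool" where
  "is_arrow e \<longleftrightarrow> is_segment e \<and> (even_point (fst e) \<longleftrightarrow> snd (dir e) = 0)"

lemma arrow_cases:
  assumes "is_arrow e"
  obtains (horizontal) x y d where "is_sign d" "even_point (x, y)" "e = ((x, y), (x + d, y))"
  | (vertical) x y d where "is_sign d" "\<not> even_point (x, y)" "e = ((x, y), (x, y + d))"
proof -
  obtain x y x' y' where e: "e = ((x, y), (x', y'))" by (cases e; cases "fst e"; cases "snd e") auto
  have seg: "\<bar>x' - x\<bar> + \<bar>y' - y\<bar> = 1"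
    using assms by (simp add: is_arrow_def is_segment_def dir_def e)
  show ?thesis
  proof (cases "even_point (x, y)")
    case True
    then have "y' = y" "is_sign (x' - x)" using assms seg by (auto simp: is_arrow_def dir_def e)
    with True show ?thesis using horizontal[of "x' - x" x y] by (simp add: e)
  next
    case False
    then have "x' = x" "is_sign (y' - y)" using assms seg by (auto simp: is_arrow_def dir_def e)
    with False show ?thesis using vertical[of "y' - y" x y] by (simp add: e)
  qed
qed

lemma even_snd_segment: "is_segment c \<Longrightarrow> even_point (snd c) \<longleftrightarrow> \<not> even_point (fst c)"
  using even_point_diff[of "snd c" "fst c"]
  unfolding even_point_iff_sqnorm[of "snd c - fst c"] by (simp add: is_segment_iff_sqnorm dir_def)

lemma is_arrow_imp_segment: "is_arrow e \<Longrightarrow> is_segment e"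
  by (simp add: is_arrow_def)

lemmas even_snd_arrow = even_snd_segment[OF is_arrow_imp_segment]

lemma is_arrow_turn_by:
  assumes "is_segment e" "is_sign t"
  shows "is_arrow (turn_by t e) \<longleftrightarrow> is_arrow e"
proof -
  obtain x y where xy: "dir e = (x, y)" by (cases "dir e")
  then have "y = 0 \<longleftrightarrow> x \<noteq> 0" using assms(1) by (auto simp: is_segment_def)
  then show ?thesis
    using assms xy by (auto simp: is_arrow_def is_segment_turn_by even_snd_segment)
qed

lemma arrow_or_swap:
  assumes "is_segment c"
  shows "is_arrow c \<or> is_arrow (prod.swap c)"
  using assms even_snd_segment[OF assms]
  by (auto simp: is_arrow_def is_segment_def dir_def)

lemma arrow_eq_if_support_eq:
  assumes "is_arrow e" "is_arrow f" "support e = support f"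
  shows "e = f"
proof (rule ccontr)
  assume "e \<noteq> f"
  then have "f = (snd e, fst e)"
    using assms(3) by (auto simp: support_def doubleton_eq_iff prod_eq_iff)
  then show False
    using assms even_snd_arrow[OF assms(1)] by (auto simp: is_arrow_def dir_def)
qed

definition shift :: "point \<Rightarrow> segment \<Rightarrow> segment" where
  "shift v = map_prod ((+) v) ((+) v)"

lemma fst_shift [simp]: "fst (shift v c) = v + fst c"
  and snd_shift [simp]: "snd (shift v c) = v + snd c"
  and dir_shift [simp]: "dir (shift v c) = dir c"
  by (simp_all add: shift_def dir_def)

lemma is_arrow_shift: "even_point v \<Longrightarrow> is_arrow (shift v e) \<longleftrightarrow> is_arrow e"
  by (simp add: is_arrow_def is_segment_def)

lemma turn_by_shift: "turn_by t (shift v c) = shift v (turn_by t c)"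
  by (simp add: turn_by_def prod_eq_iff add.assoc)

lemma parity_sign_snd_arrow:
  assumes "is_arrow e"
  shows "parity_sign (snd (snd e)) =
    (if even_point (fst e) then 1 else -1) * parity_sign (snd (fst e))"
  using assms by (cases rule: arrow_cases) (auto simp: parity_sign_def)

subsection \<open>Walks with prescribed turns\<close>

text \<open>The turn \<open>s h\<close> takes place at the terminal point of \<open>w h\<close>.\<close>

definition walk :: "(int \<Rightarrow> int) \<Rightarrow> (int \<Rightarrow> segment) \<Rightarrow> bool" where
  "walk s w \<longleftrightarrow> (\<forall>h. is_arrow (w h) \<and> is_sign (s h) \<and> w (h + 1) = turn_by (s h) (w h))"

lemma walkD:
  assumes "walk s w"
  shows "is_arrow (w h)" "is_sign (s h)" "w (h + 1) = turn_by (s h) (w h)"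
    and "fst (w (h + 1)) = snd (w h)"
  using assms by (auto simp: walk_def)

lemma walk_parity:
  assumes "walk s w"
  shows "even_point (snd (w h)) \<longleftrightarrow> (even h \<longleftrightarrow> even_point (snd (w 0)))"
proof -
  have flip: "even_point (snd (w (h + 1))) \<longleftrightarrow> \<not> even_point (snd (w h))" for h
    using even_snd_arrow[OF walkD(1)[OF assms], of "h + 1"] walkD(4)[OF assms, of h] by simp
  show ?thesis
  proof (induction h rule: int_induct[of _ 0])
    case (step1 i)
    then show ?case using flip[of i] by auto
  next
    case (step2 i)
    then show ?case using flip[of "i - 1"] by auto
  qed simp
qed

lemma walk_parity_sign:
  assumes "walk s w"
  shows "parity_sign (snd (snd (w (h + 2 * k)))) = parity_sign k * parity_sign (snd (snd (w h)))"
proof -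
  have flip: "parity_sign (snd (snd (w (h + 2)))) = - parity_sign (snd (snd (w h)))" for h
  proof -
    have two: "h + 2 = h + 1 + 1" by simp
    show ?thesis
      unfolding two parity_sign_snd_arrow[OF walkD(1)[OF assms]] walkD(4)[OF assms]
      using even_snd_arrow[OF walkD(1)[OF assms], of "h + 1"] walkD(4)[OF assms, of h] by simp
  qed
  show ?thesis
  proof (induction k rule: int_induct[of _ 0])
    case (step1 i)
    then show ?case using flip[of "h + 2 * i"] by (simp add: distrib_left flip: add.assoc)
  next
    case (step2 i)
    then show ?case
      using flip[of "h + 2 * (i - 1)"] parity_sign_add_1[of "i - 1"] by (simp add: algebra_simps)
  qed (simp add: parity_sign_def)
qed

lemma walk_parity_sign_odd:
  assumes "walk s w" "even_point (snd (w 0))"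
  shows "parity_sign (snd (snd (w (2 * k + 1)))) = parity_sign k * parity_sign (snd (snd (w 0)))"
proof -
  have "parity_sign (snd (snd (w 1))) = parity_sign (snd (snd (w 0)))"
    using parity_sign_snd_arrow[OF walkD(1)[OF assms(1)], of 1] walkD(4)[OF assms(1), of 0] assms(2)
    by simp
  then show ?thesis using walk_parity_sign[OF assms(1), of 1 k] by (simp add: add.commute)
qed

subsection \<open>Parents of oriented edges\<close>

text \<open>One step of unfolding: multiplication with \<open>1 + c i\<close> maps an arrow to the diagonal of a unit
  square, which is then replaced by two sides of the square.\<close>

definition corner :: "int \<Rightarrow> segment \<Rightarrow> point" where
  "corner c e = (fst ((1, c) \<odot> snd e), snd ((1, c) \<odot> fst e))"

definition first_child :: "int \<Rightarrow> segment \<Rightarrow> segment" where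
  "first_child c e = ((1, c) \<odot> fst e, corner c e)"

definition second_child :: "int \<Rightarrow> segment \<Rightarrow> segment" where
  "second_child c e = (corner c e, (1, c) \<odot> snd e)"

definition corner_turn :: "int \<Rightarrow> point \<Rightarrow> int" where
  "corner_turn c p = c * parity_sign (snd p)"

text \<open>The turn at the odd end point, which is a corner, determines the diagonal.\<close>

definition parent :: "int \<Rightarrow> segment \<Rightarrow> segment" where
  "parent c e =
     (if even_point (fst e)
      then (contract c (fst e), contract c (snd e + (0, corner_turn c (snd e)) \<odot> dir e))
      else (contract c (fst e + (0, corner_turn c (fst e)) \<odot> dir e), contract c (snd e)))"

lemma is_sign_corner_turn: "is_sign c \<Longrightarrow> is_sign (corner_turn c p)"
  using is_sign_parity_sign[of "snd p"] by (auto simp: corner_turn_def)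

lemma corner_turn_cong: "snd p = snd q \<Longrightarrow> corner_turn c p = corner_turn c q"
  by (simp add: corner_turn_def)

lemma fst_first_child [simp]: "fst (first_child c e) = (1, c) \<odot> fst e"
  and snd_first_child [simp]: "snd (first_child c e) = corner c e"
  and fst_second_child [simp]: "fst (second_child c e) = corner c e"
  and snd_second_child [simp]: "snd (second_child c e) = (1, c) \<odot> snd e"
  by (simp_all add: first_child_def second_child_def)

lemma is_arrow_first_child: "is_sign c \<Longrightarrow> is_arrow e \<Longrightarrow> is_arrow (first_child c e)"
  by (erule arrow_cases[of e])
    (auto simp: is_arrow_def is_segment_def first_child_def corner_def dir_def)

lemma is_arrow_second_child: "is_sign c \<Longrightarrow> is_arrow e \<Longrightarrow> is_arrow (second_child c e)"
  by (erule arrow_cases[of e])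
    (auto simp: is_arrow_def is_segment_def second_child_def corner_def dir_def)

lemma odd_corner: "is_sign c \<Longrightarrow> is_arrow e \<Longrightarrow> \<not> even_point (corner c e)"
  using even_snd_arrow[OF is_arrow_first_child[of c e]] by simp

lemma second_child_eq_turn_by:
  assumes "is_sign c" "is_arrow e"
  shows "second_child c e = turn_by (corner_turn c (corner c e)) (first_child c e)"
  using assms(2,1)
  by (cases rule: arrow_cases)
    (auto simp: first_child_def second_child_def corner_def turn_by_def dir_def
      corner_turn_def parity_sign_def)

lemma first_child_turn_by:
  assumes "is_sign c" "is_arrow e"
  shows "first_child c (turn_by t e) = turn_by t (second_child c e)"
  using assms(2,1)
  by (cases rule: arrow_cases)
    (auto simp: first_child_def second_child_def corner_def turn_by_def dir_def)

lemma parent_first_child [simp]: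
  assumes "is_sign c" "is_arrow e"
  shows "parent c (first_child c e) = e"
proof -
  have "corner c e + (0, corner_turn c (corner c e)) \<odot> dir (first_child c e) = (1, c) \<odot> snd e"
    using arg_cong[OF second_child_eq_turn_by[OF assms], of snd] by (simp add: snd_turn_by)
  with assms(1) show ?thesis by (simp add: parent_def)
qed

lemma parent_second_child [simp]:
  assumes "is_sign c" "is_arrow e"
  shows "parent c (second_child c e) = e"
proof -
  define t where "t = corner_turn c (corner c e)"
  have "t * t = 1" using is_sign_corner_turn[OF assms(1), of "corner c e"] by (auto simp: t_def)
  then have "(0, t) \<odot> ((0, t) \<odot> dir (first_child c e)) = - dir (first_child c e)"
    by (cases "dir (first_child c e)") (simp flip: mult.assoc)
  moreover have "dir (second_child c e) = (0, t) \<odot> dir (first_child c e)"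
    by (simp add: second_child_eq_turn_by[OF assms] t_def)
  ultimately have "corner c e + (0, t) \<odot> dir (second_child c e) = (1, c) \<odot> fst e"
    by (simp add: dir_def)
  with assms odd_corner[OF assms] show ?thesis by (simp add: parent_def t_def)
qed

lemma parent_diagonalE:
  assumes "is_sign c" "is_arrow e"
  obtains p d where "is_sign d" "even_point p"
    "parent c e = (contract c p, contract c (p + (d, corner_turn c p * d)))"
    "even_point (fst e) \<Longrightarrow> e = (p, p + (d, 0))"
    "\<not> even_point (fst e) \<Longrightarrow> e = (p + (d, 0), p + (d, corner_turn c p * d))"
  using assms(2)
proof (cases rule: arrow_cases)
  case (horizontal x y d)
  moreover have "corner_turn c (x + d, y) = corner_turn c (x, y)" by (rule corner_turn_cong) simp
  ultimately show ?thesis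
    by (intro that[of d "(x, y)"]) (simp_all add: parent_def dir_def del: contract.simps)
next
  case (vertical x y d)
  define t d' where "t = corner_turn c (x, y)" and "d' = t * d"
  have "is_sign t" using is_sign_corner_turn[OF assms(1)] by (simp add: t_def)
  then have "t * d' = d" "is_sign d'" "even_point (x - d', y)"
    using vertical(1,2) by (auto simp: d'_def)
  moreover have "corner_turn c (x - d', y) = t" unfolding t_def by (rule corner_turn_cong) simp
  ultimately show ?thesis
    using vertical by (intro that[of d' "(x - d', y)"])
      (simp_all add: parent_def dir_def flip: t_def d'_def del: contract.simps)
qed

lemma is_arrow_parent:
  assumes "is_sign c" "is_arrow e"
  shows "is_arrow (parent c e)"
proof -
  obtain p d where p: "is_sign d" "even_point p"
    and parent: "parent c e = (contract c p, contract c (p + (d, corner_turn c p * d)))"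
    using parent_diagonalE[OF assms] by metis
  have even_contract: "even_point (contract c p) \<longleftrightarrow> even (snd p)"
    using even_snd_gmult[OF assms(1)] gmult_contract[OF assms(1) p(2)] by metis
  let ?d = "if even (snd p) then (d, 0) else (0, - (c * d))"
  have "(d, corner_turn c p * d) = (1, c) \<odot> ?d"
    using assms(1) by (auto simp: corner_turn_def parity_sign_def)
  then have "parent c e = (contract c p, contract c p + ?d)"
    unfolding parent using contract_gmult_add[OF assms(1)] by (simp add: add.commute)
  then show ?thesis
    using assms(1) p(1) even_contract by (auto simp: is_arrow_def is_segment_def dir_def)
qed

lemma children_parent:
  assumes "is_sign c" "is_arrow e"
  shows "even_point (fst e) \<Longrightarrow> first_child c (parent c e) = e"
    and "\<not> even_point (fst e) \<Longrightarrow> second_child c (parent c e) = e"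
proof -
  obtain p d where p: "is_sign d" "even_point p"
    and parent: "parent c e = (contract c p, contract c (p + (d, corner_turn c p * d)))"
    and e: "even_point (fst e) \<Longrightarrow> e = (p, p + (d, 0))"
      "\<not> even_point (fst e) \<Longrightarrow> e = (p + (d, 0), p + (d, corner_turn c p * d))"
    using parent_diagonalE[OF assms] by metis
  have "even_point (p + (d, corner_turn c p * d))"
    using is_sign_corner_turn[OF assms(1), of p] p by auto
  then show "even_point (fst e) \<Longrightarrow> first_child c (parent c e) = e"
    "\<not> even_point (fst e) \<Longrightarrow> second_child c (parent c e) = e"
    using assms(1) p(2) e
    by (simp_all add: parent first_child_def second_child_def corner_def gmult_contract prod_eq_iff)
qed

lemma parent_shift:
  assumes "is_sign c" "even_point v"
  shows "parent c (shift ((1, c) \<odot> v) e) = shift v (parent c e)"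
proof -
  have "corner_turn c ((1, c) \<odot> v + p) = corner_turn c p" for p
    unfolding corner_turn_def using assms even_snd_gmult[of c v]
    by (intro arg_cong[of _ _ "(*) c"] parity_sign_cong) simp
  then show ?thesis
    using assms(1) by (simp add: parent_def add.assoc contract_gmult_add prod_eq_iff)
qed

subsection \<open>Contraction to the square of side two\<close>

text \<open>Four times the squared distance of the midpoint from 0.\<close>

definition size_arrow :: "segment \<Rightarrow> int" where
  "size_arrow e = sqnorm (fst e + snd e)"

lemma size_arrow_parent_less:
  assumes "is_sign c" "is_arrow e" "size_arrow e > 5"
  shows "size_arrow (parent c e) < size_arrow e"
proof -
  let ?q = "parent c e"
  have q: "is_arrow ?q" using is_arrow_parent[OF assms(1,2)] .
  have unit: "sqnorm (dir (first_child c ?q)) = 1" "sqnorm (dir (second_child c ?q)) = 1"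
    using is_arrow_first_child[OF assms(1) q] is_arrow_second_child[OF assms(1) q]
    by (simp_all add: is_arrow_def is_segment_iff_sqnorm)
  have double: "2 * size_arrow ?q = sqnorm ((1, c) \<odot> fst ?q + (1, c) \<odot> snd ?q)"
    using assms(1) by (simp add: size_arrow_def sqnorm_one_plus flip: gmult_add_right)
  show ?thesis
  proof (cases "even_point (fst e)")
    case True
    note e = children_parent(1)[OF assms(1,2) True]
    have "2 * size_arrow ?q = sqnorm ((fst e + snd e) + dir (second_child c ?q))"
      unfolding double using arg_cong[OF e, of fst] arg_cong[OF e, of snd] by (simp add: dir_def)
    then show ?thesis
      using sqnorm_halved_less[OF _ unit(2)] assms(3) by (simp add: size_arrow_def)
  next
    case False
    note e = children_parent(2)[OF assms(1,2) False]
    have "2 * size_arrow ?q = sqnorm ((fst e + snd e) + - dir (first_child c ?q))"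
      unfolding double using arg_cong[OF e, of fst] arg_cong[OF e, of snd]
      by (simp add: dir_def add.commute)
    then show ?thesis
      using sqnorm_halved_less[of _ _ "- dir (first_child c ?q)"] unit(1) assms(3)
      by (simp add: size_arrow_def)
  qed
qed

abbreviation east :: segment where
  "east \<equiv> ((0, 0), (1, 0))"

abbreviation west :: segment where
  "west \<equiv> ((0, 0), (-1, 0))"

definition center_arrows :: "segment set" where
  "center_arrows = {east, west, ((0, 1), (0, 0)), ((0, -1), (0, 0))}"

definition square_arrows :: "segment set" where
  "square_arrows = center_arrows \<union>
     {((1, 0), (1, 1)), ((1, 0), (1, -1)), ((-1, 0), (-1, 1)), ((-1, 0), (-1, -1)),
      ((1, 1), (0, 1)), ((1, -1), (0, -1)), ((-1, 1), (0, 1)), ((-1, -1), (0, -1))}"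

lemma is_arrow_square: "e \<in> square_arrows \<Longrightarrow> is_arrow e"
  by (auto simp: square_arrows_def center_arrows_def is_arrow_def is_segment_def dir_def)

lemma east_west_arrows [simp]:
  "east \<in> center_arrows" "west \<in> center_arrows" "is_arrow east" "is_arrow west"
  by (simp_all add: center_arrows_def is_arrow_def is_segment_def dir_def)

lemma center_arrows_iff:
  assumes "is_arrow e"
  shows "e \<in> center_arrows \<longleftrightarrow> fst e = 0 \<or> snd e = 0"
  using assms
  by (cases rule: arrow_cases) (auto simp: center_arrows_def zero_prod_def add_eq_0_iff)

lemma turn_by_opposite:
  assumes "is_arrow e" "is_arrow f" "snd e = 0" "snd f = 0" "e \<noteq> f"
  shows "turn_by (- t) e = turn_by t f"
proof -
  have "e \<in> center_arrows" "f \<in> center_arrows" using assms by (simp_all add: center_arrows_iff)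
  then show ?thesis
    using assms(3-5) by (auto simp: center_arrows_def zero_prod_def turn_by_def dir_def)
qed

lemma square_arrows_if_size_le:
  assumes "is_arrow e" "size_arrow e \<le> 5"
  shows "e \<in> square_arrows"
proof -
  have small: "-2 \<le> z \<and> z \<le> 2" if "z\<^sup>2 \<le> 5" for z :: int
  proof -
    have "\<not> 3 \<le> \<bar>z\<bar>" using power_mono[of 3 "\<bar>z\<bar>" 2] that by auto
    then show ?thesis by linarith
  qed
  obtain X Y where XY: "fst e + snd e = (X, Y)" by (cases "fst e + snd e")
  then have "X\<^sup>2 + Y\<^sup>2 \<le> 5" using assms(2) by (simp add: size_arrow_def sqnorm_def)
  then have bounds: "-2 \<le> X \<and> X \<le> 2" "-2 \<le> Y \<and> Y \<le> 2"
    using small[of X] small[of Y] zero_le_power2[of X] zero_le_power2[of Y] by linarith+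
  with assms(1) show ?thesis
  proof (cases rule: arrow_cases)
    case (horizontal x y d)
    then have "x = -1 \<or> x = 0 \<or> x = 1" "y = -1 \<or> y = 0 \<or> y = 1"
      using XY bounds by (auto simp: horizontal(3))
    with horizontal assms(2) show ?thesis
      by (elim disjE) (simp_all add: square_arrows_def center_arrows_def size_arrow_def sqnorm_def)
  next
    case (vertical x y d)
    then have "x = -1 \<or> x = 0 \<or> x = 1" "y = -1 \<or> y = 0 \<or> y = 1"
      using XY bounds by (auto simp: vertical(3))
    with vertical assms(2) show ?thesis
      by (elim disjE) (simp_all add: square_arrows_def center_arrows_def size_arrow_def sqnorm_def)
  qed
qed

lemma parent_center: "is_sign c \<Longrightarrow> e \<in> center_arrows \<Longrightarrow> parent c e = e"
  unfolding center_arrows_def insert_iff empty_iff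
  by (elim disjE FalseE) (simp_all add: parent_def dir_def corner_turn_def parity_sign_def)

lemma parent_square: "is_sign c \<Longrightarrow> e \<in> square_arrows \<Longrightarrow> parent c e \<in> square_arrows"
  unfolding square_arrows_def center_arrows_def Un_iff insert_iff empty_iff
  by (elim disjE FalseE) (simp_all add: parent_def dir_def corner_turn_def parity_sign_def)

lemma parent_parent_center:
  assumes "e \<in> square_arrows" "is_sign c"
  shows "parent c (parent c e) \<in> center_arrows"
  using assms(2,1) unfolding square_arrows_def center_arrows_def Un_iff insert_iff empty_iff
  by (elim disjE FalseE) (simp_all add: parent_def dir_def corner_turn_def parity_sign_def)

text \<open>The arrows of the square whose ancestors never reach 0 when the letters from \<open>c\<close> on
  alternate.\<close>

definition survivors :: "int \<Rightarrow> segment set" where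
  "survivors c =
     (if c = 1 then {((1, 1), (0, 1)), ((1, 0), (1, -1)), ((-1, -1), (0, -1)), ((-1, 0), (-1, 1))}
      else {((1, 0), (1, 1)), ((1, -1), (0, -1)), ((-1, 0), (-1, -1)), ((-1, 1), (0, 1))})"

lemma card_survivors: "card (survivors c) = 4"
  by (simp add: survivors_def)

lemma survivors_subset: "survivors c \<subseteq> square_arrows - center_arrows"
  by (simp add: survivors_def square_arrows_def center_arrows_def)

lemma parent_survivors:
  assumes "is_sign c"
  shows "bij_betw (parent c) (survivors c) (survivors (- c))"
  using assms
  by (elim disjE) (simp_all add: bij_betw_def survivors_def parent_def dir_def
    corner_turn_def parity_sign_def insert_commute)

lemma parent_not_survivor:
  assumes "is_sign c" "e \<in> square_arrows" "e \<notin> survivors c"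
  shows "parent c e \<in> center_arrows"
  using assms unfolding square_arrows_def center_arrows_def Un_iff insert_iff empty_iff
  by (elim disjE FalseE)
    (simp_all add: survivors_def parent_def dir_def corner_turn_def parity_sign_def)

text \<open>The translation vectors in the next two lemmas are vertices deep inside the curve that
  replaces \<open>east\<close> after five unfoldings, found by inspection of these curves.\<close>

lemma center_shift_descends_from_east:
  assumes "is_sign c0" "is_sign c1" "is_sign c2" "is_sign c3" "is_sign c4"
  obtains v where "even_point v" "\<And>e. e \<in> center_arrows \<Longrightarrow>
    parent c4 (parent c3 (parent c2 (parent c1 (parent c0 (shift v e))))) = east"
proof -
  define v where "v = fst (first_child c0 (second_child c1
    ((if if c1 = c2 then c4 = c2 else c3 \<noteq> c2 then second_child else first_child) c2
      (second_child c3 (first_child c4 east)))))"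
  have "even_point v" using assms(1) by (simp add: v_def)
  moreover have "parent c4 (parent c3 (parent c2 (parent c1 (parent c0 (shift v e))))) = east"
    if "e \<in> center_arrows" for e
    using that assms unfolding v_def center_arrows_def insert_iff empty_iff
    by (elim disjE FalseE; hypsubst_thin)
      (simp_all add: first_child_def second_child_def corner_def shift_def parent_def dir_def
        corner_turn_def parity_sign_def)
  ultimately show ?thesis using that by blast
qed

lemma square_shift_descends_from_east:
  assumes "is_sign c" "e \<in> square_arrows"
  shows "parent c (parent (- c) (parent c (parent (- c) (parent c (shift (4, 2 * c) e))))) = east"
  using assms unfolding square_arrows_def center_arrows_def Un_iff insert_iff empty_iff
  by (elim disjE FalseE)
    (simp_all add: shift_def parent_def dir_def corner_turn_def parity_sign_def)

lemma finite_arrows_near: "finite {e. is_arrow e \<and> sqnorm (fst e) \<le> r}"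
proof -
  have bound: "\<bar>x\<bar> \<le> r" if "x\<^sup>2 \<le> r" for x :: int
  proof -
    have "\<bar>x\<bar> * 1 \<le> \<bar>x\<bar> * \<bar>x\<bar>" if "x \<noteq> 0" using that by (intro mult_left_mono) auto
    with that show ?thesis by (cases "x = 0") (simp_all add: power2_eq_square)
  qed
  let ?A = "(\<lambda>(p, d). (p, p + d)) ` (({-r..r} \<times> {-r..r}) \<times> ({-1..1} \<times> {-1..1}))"
  have "e \<in> ?A" if "is_arrow e" "sqnorm (fst e) \<le> r" for e
  proof -
    obtain x y where xy: "fst e = (x, y)" by (cases "fst e")
    then have "x\<^sup>2 \<le> r" "y\<^sup>2 \<le> r"
      using that(2) zero_le_power2[of x] zero_le_power2[of y]
      unfolding sqnorm_def xy fst_conv snd_conv by linarith+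
    then have "fst e \<in> {-r..r} \<times> {-r..r}"
      using bound[of x] bound[of y] by (auto simp: xy abs_le_iff)
    moreover have "dir e \<in> {-1..1} \<times> {-1..1}"
      using that(1) by (cases "dir e") (auto simp: is_arrow_def is_segment_def)
    moreover have "e = (fst e, fst e + dir e)" by (simp add: dir_def)
    ultimately show ?thesis by (intro image_eqI[of _ _ "(fst e, dir e)"]) auto
  qed
  then have "{e. is_arrow e \<and> sqnorm (fst e) \<le> r} \<subseteq> ?A" by blast
  moreover have "finite ?A" by blast
  ultimately show ?thesis by (rule finite_subset)
qed

subsection \<open>The hierarchical turn function\<close>

text \<open>Here \<open>\<alpha> n\<close> stands for \<open>a (2 ^ n)\<close>, and \<open>turn n\<close> gives the turns at the vertices of the \<open>n\<close>-th
  derivative of the covering, rescaled to the unit lattice with center 0.\<close>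

locale folding_plane =
  fixes \<alpha> :: "nat \<Rightarrow> int" and \<epsilon> :: int
  assumes sign_letter [simp]: "is_sign (\<alpha> n)" and sign_center [simp]: "is_sign \<epsilon>"
begin

lemma letter_nonzero [simp]: "\<alpha> n \<noteq> 0"
  using sign_letter[of n] by (metis one_neq_zero neg_equal_0_iff_equal)

function turn :: "nat \<Rightarrow> point \<Rightarrow> int" where
  "turn n p = (if p = 0 then \<epsilon> else if even_point p then turn (Suc n) (contract (\<alpha> n) p)
     else corner_turn (\<alpha> n) p)"
  by auto
termination
proof (relation "Wellfounded.measure (\<lambda>(n, p). nat (sqnorm p))", goal_cases)
  case (2 n p)
  define q where "q = contract (\<alpha> n) p"
  have p: "p = (1, \<alpha> n) \<odot> q" using 2 gmult_contract[OF sign_letter] by (simp add: q_def)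
  then have "q \<noteq> 0" using 2 by auto
  then have "sqnorm q > 0" by (rule sqnorm_pos)
  then show ?case by (simp flip: q_def) (simp add: p sqnorm_one_plus)
qed simp

declare turn.simps [simp del]

lemma turn_0 [simp]: "turn n 0 = \<epsilon>"
  by (simp add: turn.simps)

lemma turn_odd: "\<not> even_point p \<Longrightarrow> turn n p = corner_turn (\<alpha> n) p"
  by (subst turn.simps) auto

lemma turn_even [simp]: "turn n ((1, \<alpha> n) \<odot> p) = turn (Suc n) p"
  by (cases "p = 0") (simp_all add: turn.simps[of n "(1, \<alpha> n) \<odot> p"])

lemma is_sign_turn [simp]: "is_sign (turn n p)"
proof (induction n p rule: turn.induct)
  case (1 n p)
  then show ?case
    by (subst (1 2) turn.simps) (use is_sign_corner_turn[OF sign_letter] in auto)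
qed

definition successor :: "nat \<Rightarrow> segment \<Rightarrow> segment" where
  "successor n e = turn_by (turn n (snd e)) e"

lemma fst_successor [simp]: "fst (successor n e) = snd e"
  by (simp add: successor_def)

lemma is_arrow_successor [simp]: "is_arrow e \<Longrightarrow> is_arrow (successor n e)"
  by (simp add: successor_def is_arrow_turn_by is_arrow_imp_segment)

lemma successor_inject:
  assumes "successor n e = successor n f"
  shows "e = f"
proof -
  have "snd e = snd f" using arg_cong[OF assms, of fst] by simp
  then show ?thesis
    using assms turn_by_inject[of "turn n (snd f)"] by (simp add: successor_def)
qed

lemma successor_first_child:
  "is_arrow q \<Longrightarrow> successor n (first_child (\<alpha> n) q) = second_child (\<alpha> n) q"
  by (simp add: successor_def turn_odd odd_corner second_child_eq_turn_by)

lemma successor_second_child: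
  "is_arrow q \<Longrightarrow> successor n (second_child (\<alpha> n) q) = first_child (\<alpha> n) (successor (Suc n) q)"
  by (simp add: successor_def first_child_turn_by)

lemma child_cases:
  assumes "is_arrow e"
  obtains (first) q where "is_arrow q" "e = first_child (\<alpha> n) q" "\<not> even_point (snd e)"
  | (second) q where "is_arrow q" "e = second_child (\<alpha> n) q" "even_point (snd e)"
  using children_parent[OF sign_letter assms, of n] even_snd_arrow[OF assms]
    is_arrow_parent[OF sign_letter assms, of n] by metis

lemma parent_successor:
  assumes "is_arrow e"
  shows "\<not> even_point (snd e) \<Longrightarrow> parent (\<alpha> n) (successor n e) = parent (\<alpha> n) e"
    and "even_point (snd e) \<Longrightarrow> parent (\<alpha> n) (successor n e) = successor (Suc n) (parent (\<alpha> n) e)"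
    and "even_point (snd e) \<Longrightarrow> snd e = (1, \<alpha> n) \<odot> snd (parent (\<alpha> n) e)"
  using assms
  by (cases rule: child_cases[of _ n];
    simp add: successor_first_child successor_second_child odd_corner)+

primrec multiplier :: "nat \<Rightarrow> nat \<Rightarrow> point" where
  "multiplier n 0 = (1, 0)"
| "multiplier n (Suc k) = (1, \<alpha> n) \<odot> multiplier (Suc n) k"

lemma even_point_multiplier: "k \<ge> 1 \<or> even_point p \<Longrightarrow> even_point (multiplier n k \<odot> p)"
  by (cases k) (auto simp: gmult_assoc)

lemma turn_periodic:
  assumes "p \<noteq> 0"
  obtains k where "k \<ge> 1" "\<And>q. turn n (p + multiplier n k \<odot> q) = turn n p"
proof -
  have "\<exists>k\<ge>1. \<forall>q. turn n (p + multiplier n k \<odot> q) = turn n p"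
    using assms
  proof (induction n p rule: turn.induct)
    case (1 n p)
    show ?case
    proof (cases "even_point p")
      case False
      have "turn n (p + multiplier n 2 \<odot> q) = turn n p" for q
      proof -
        have "multiplier n 2 \<odot> q = (1, \<alpha> n) \<odot> ((1, \<alpha> (Suc n)) \<odot> q)"
          by (simp only: numeral_2_eq_2 multiplier.simps gmult_assoc gmult_1_left)
        then have "even_point (multiplier n 2 \<odot> q)" "even (snd (multiplier n 2 \<odot> q))"
          by (simp_all add: even_snd_gmult)
        with False show ?thesis
          using parity_sign_cong[of "snd (p + multiplier n 2 \<odot> q)" "snd p"]
          by (simp add: turn_odd corner_turn_def)
      qed
      then show ?thesis by (intro exI[of _ 2]) auto
    next
      case True
      define q where "q = contract (\<alpha> n) p"
      have p: "p = (1, \<alpha> n) \<odot> q" using True gmult_contract[OF sign_letter] by (simp add: q_def)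
      then have "q \<noteq> 0" using 1 by auto
      then obtain k where "\<And>r. turn (Suc n) (q + multiplier (Suc n) k \<odot> r) = turn (Suc n) q"
        using 1 True unfolding q_def by blast
      then have "turn n (p + multiplier n (Suc k) \<odot> r) = turn n p" for r
        by (simp add: p gmult_assoc flip: gmult_add_right)
      then show ?thesis by (intro exI[of _ "Suc k"]) auto
    qed
  qed
  then show ?thesis using that by blast
qed

subsection \<open>Ancestors\<close>

primrec ancestor :: "nat \<Rightarrow> nat \<Rightarrow> segment \<Rightarrow> segment" where
  "ancestor n 0 e = e"
| "ancestor n (Suc k) e = parent (\<alpha> (n + k)) (ancestor n k e)"

lemma ancestor_add: "ancestor n (k + l) e = ancestor (n + k) l (ancestor n k e)"
  by (induction l) (simp_all add: add.assoc)

lemma ancestor_Suc_parent: "ancestor n (Suc k) e = ancestor (Suc n) k (parent (\<alpha> n) e)"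
  using ancestor_add[of n 1 k e] by simp

lemma is_arrow_ancestor [simp]: "is_arrow e \<Longrightarrow> is_arrow (ancestor n k e)"
  by (induction k) (simp_all add: is_arrow_parent)

lemma ancestor_center [simp]: "e \<in> center_arrows \<Longrightarrow> ancestor n k e = e"
  by (induction k) (simp_all add: parent_center)

lemma ancestor_surj:
  assumes "is_arrow f"
  obtains e where "is_arrow e" "ancestor n k e = f"
proof -
  have "\<exists>e. is_arrow e \<and> ancestor n k e = f"
    using assms
  proof (induction k arbitrary: f)
    case (Suc k)
    then obtain e where "is_arrow e" "ancestor n k e = first_child (\<alpha> (n + k)) f"
      using is_arrow_first_child[OF sign_letter] by metis
    with Suc.prems show ?case by (intro exI[of _ e]) simp
  qed auto
  then show ?thesis using that by blast
qed

lemma ancestor_shift: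
  assumes "even_point v"
  shows "ancestor n k (shift (multiplier n k \<odot> v) e) = shift v (ancestor n k e)"
proof (induction k arbitrary: n e)
  case (Suc k)
  then show ?case
    by (simp only: ancestor_Suc_parent)
      (simp add: assms even_point_multiplier gmult_assoc parent_shift)
qed (simp add: shift_def)

lemma ancestor_in_square_mono:
  assumes "ancestor n k e \<in> square_arrows" "k \<le> l"
  shows "ancestor n l e \<in> square_arrows"
  using assms(2,1) by (induction l rule: dec_induct) (simp_all add: parent_square)

lemma ancestor_eventually_in_square:
  assumes "is_arrow e"
  shows "\<forall>\<^sub>F k in sequentially. ancestor n k e \<in> square_arrows"
proof -
  have "\<exists>k. ancestor n k e \<in> square_arrows"
    using assms
  proof (induction "nat (size_arrow e)" arbitrary: n e rule: less_induct)
    case less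
    show ?case
    proof (cases "size_arrow e \<le> 5")
      case True
      then have "ancestor n 0 e \<in> square_arrows" using square_arrows_if_size_le less.prems by simp
      then show ?thesis by blast
    next
      case False
      then have "size_arrow (parent (\<alpha> n) e) < size_arrow e"
        using size_arrow_parent_less less.prems by simp
      then obtain k where "ancestor (Suc n) k (parent (\<alpha> n) e) \<in> square_arrows"
        using less.hyps[of "parent (\<alpha> n) e" "Suc n"] less.prems False
        by (auto simp: is_arrow_parent)
      then show ?thesis unfolding ancestor_Suc_parent[symmetric] by blast
    qed
  qed
  then obtain k where "ancestor n k e \<in> square_arrows" by blast
  then show ?thesis using ancestor_in_square_mono by (blast intro: eventually_sequentiallyI)
qed

lemma ancestor_in_center_if_repeated:
  assumes "ancestor n k e \<in> square_arrows" "\<alpha> (n + k) = \<alpha> (Suc (n + k))"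
  shows "ancestor n (Suc (Suc k)) e \<in> center_arrows"
  using parent_parent_center[OF assms(1), of "\<alpha> (n + k)"] assms(2) by simp

subsection \<open>Arrows lying on the same curve\<close>

abbreviation same_curve :: "nat \<Rightarrow> segment \<Rightarrow> segment \<Rightarrow> bool" where
  "same_curve n \<equiv> equivclp (\<lambda>e f. is_arrow e \<and> f = successor n e)"

lemma same_curve_arrow: "same_curve n e f \<Longrightarrow> is_arrow e \<Longrightarrow> is_arrow f"
  by (induction rule: equivclp_induct) auto

lemma same_curve_successor: "is_arrow e \<Longrightarrow> same_curve n e (successor n e)"
  by (intro r_into_equivclp) simp

lemma same_curve_children:
  assumes "is_arrow q"
  shows "same_curve n (first_child (\<alpha> n) q) (second_child (\<alpha> n) q)"
  using same_curve_successor[OF is_arrow_first_child[OF sign_letter assms], of n n]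
  by (simp add: successor_first_child assms)

lemma same_curve_first_child:
  "same_curve (Suc n) q r \<Longrightarrow> same_curve n (first_child (\<alpha> n) q) (first_child (\<alpha> n) r)"
proof (induction rule: equivclp_induct)
  case (step r r')
  have "same_curve n (first_child (\<alpha> n) q) (first_child (\<alpha> n) (successor (Suc n) q))"
    if q: "is_arrow q" for q
  proof -
    note same_curve_children[OF q]
    also have "same_curve n (second_child (\<alpha> n) q) (first_child (\<alpha> n) (successor (Suc n) q))"
      using same_curve_successor[OF is_arrow_second_child[OF sign_letter q], of n n]
      by (simp add: successor_second_child q)
    finally show ?thesis .
  qed
  with step show ?case by (meson equivclp_sym equivclp_trans)
qed simp

lemma same_curve_first_child_parent:
  assumes "is_arrow e"
  shows "same_curve n (first_child (\<alpha> n) (parent (\<alpha> n) e)) e"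
  using assms
proof (cases rule: child_cases[of _ n])
  case (second q)
  then show ?thesis using same_curve_children[of q n] by simp
qed simp

lemma same_curve_if_parents:
  assumes "same_curve (Suc n) (parent (\<alpha> n) e) (parent (\<alpha> n) f)" "is_arrow e" "is_arrow f"
  shows "same_curve n e f"
  using same_curve_first_child[OF assms(1)] same_curve_first_child_parent[OF assms(2)]
    same_curve_first_child_parent[OF assms(3)] by (meson equivclp_sym equivclp_trans)

lemma same_curve_if_ancestors:
  assumes "same_curve (n + k) (ancestor n k e) (ancestor n k f)" "is_arrow e" "is_arrow f"
  shows "same_curve n e f"
  using assms by (induction k) (auto dest: same_curve_if_parents)

text \<open>Passage to the parent never removes the vertex 0, so that two arrows meeting there are
  identified here.\<close>

definition past_center :: "segment \<Rightarrow> segment" where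
  "past_center e = (if snd e = 0 then turn_by \<epsilon> e else e)"

lemma same_curve_past_center: "is_arrow e \<Longrightarrow> same_curve n e (past_center e)"
  using same_curve_successor[of e n] turn_0[of n]
  by (cases "snd e = 0") (simp_all add: past_center_def successor_def[of n e])

lemma past_center_eq_center: "e \<in> center_arrows \<Longrightarrow> past_center e \<in> {east, west}"
  unfolding past_center_def
  by (rule disjE[OF sign_center]) (auto simp: center_arrows_def turn_by_def dir_def zero_prod_def)

lemma past_center_idem [simp]: "is_arrow e \<Longrightarrow> past_center (past_center e) = past_center e"
  using past_center_eq_center[of e] by (auto simp: past_center_def center_arrows_iff zero_prod_def)

lemma past_center_parent:
  assumes "is_arrow e" "is_sign c"
  shows "past_center (parent c (past_center e)) = past_center (parent c e)"
proof (cases "snd e = 0")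
  case True
  then have e: "e \<in> center_arrows" using assms(1) by (simp add: center_arrows_iff)
  then have "past_center e \<in> center_arrows"
    using past_center_eq_center[OF e] by (auto simp: center_arrows_def)
  with e show ?thesis using assms by (simp add: parent_center)
qed (simp add: past_center_def)

lemma past_center_ancestor_mono:
  assumes "past_center (ancestor n k e) = past_center (ancestor n k f)" "k \<le> l"
    and "is_arrow e" "is_arrow f"
  shows "past_center (ancestor n l e) = past_center (ancestor n l f)"
  using \<open>k \<le> l\<close>
proof (induction l rule: dec_induct)
  case (step l)
  then show ?case
    using past_center_parent[of "ancestor n l e"] past_center_parent[of "ancestor n l f"] assms(3,4)
    by (metis ancestor.simps(2) is_arrow_ancestor sign_letter)
qed (rule assms(1))

text \<open>Any vertex other than 0 disappears in some derivative.\<close>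

lemma past_center_ancestor_successor:
  assumes "is_arrow e"
  shows "\<exists>k. past_center (ancestor n k e) = past_center (ancestor n k (successor n e))"
  using assms
proof (induction "nat (sqnorm (snd e))" arbitrary: e n rule: less_induct)
  case less
  let ?p = "parent (\<alpha> n)"
  consider "\<not> even_point (snd e)" | "snd e = 0" | "even_point (snd e)" "snd e \<noteq> 0" by auto
  then show ?case
  proof cases
    case 1
    then have "ancestor n 1 e = ancestor n 1 (successor n e)"
      using parent_successor(1)[OF less.prems] by simp
    then show ?thesis by metis
  next
    case 2
    then have "past_center (ancestor n 0 e) = past_center (ancestor n 0 (successor n e))"
      using past_center_idem[OF less.prems] by (simp add: past_center_def successor_def)
    then show ?thesis by blast
  next
    case 3
    have "sqnorm (snd e) = 2 * sqnorm (snd (?p e))"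
      using parent_successor(3)[OF less.prems 3(1), of n] sqnorm_one_plus[OF sign_letter] by metis
    moreover have "sqnorm (snd e) > 0" using 3(2) by (rule sqnorm_pos)
    ultimately obtain k where "past_center (ancestor (Suc n) k (?p e)) =
        past_center (ancestor (Suc n) k (successor (Suc n) (?p e)))"
      using less.hyps[of "?p e" "Suc n"] is_arrow_parent[OF sign_letter less.prems] by auto
    then have "past_center (ancestor n (Suc k) e) =
        past_center (ancestor n (Suc k) (successor n e))"
      unfolding ancestor_Suc_parent parent_successor(2)[OF less.prems 3(1)] .
    then show ?thesis by blast
  qed
qed

lemma same_curve_iff_ancestors_meet:
  assumes "is_arrow e" "is_arrow f"
  shows "same_curve n e f \<longleftrightarrow> (\<exists>k. past_center (ancestor n k e) = past_center (ancestor n k f))"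
proof
  assume "same_curve n e f"
  then show "\<exists>k. past_center (ancestor n k e) = past_center (ancestor n k f)"
  proof (induction rule: equivclp_induct)
    case (step g h)
    have g: "is_arrow g" using step.hyps(1) assms(1) by (rule same_curve_arrow)
    then have arrows: "is_arrow g" "is_arrow h" using step.hyps(2) by auto
    obtain k where "past_center (ancestor n k e) = past_center (ancestor n k g)"
      using step.IH by blast
    moreover obtain l where "past_center (ancestor n l g) = past_center (ancestor n l h)"
      using past_center_ancestor_successor step.hyps(2) arrows by metis
    ultimately have "past_center (ancestor n (max k l) e) = past_center (ancestor n (max k l) h)"
      using past_center_ancestor_mono[of n k e g "max k l"]
        past_center_ancestor_mono[of n l g h "max k l"] arrows assms(1) by simp
    then show ?case by blast
  qed simp
next
  assume "\<exists>k. past_center (ancestor n k e) = past_center (ancestor n k f)"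
  then obtain k where k: "past_center (ancestor n k e) = past_center (ancestor n k f)" by blast
  have "same_curve (n + k) (ancestor n k e) (past_center (ancestor n k f))"
    using same_curve_past_center[of "ancestor n k e" "n + k"] assms(1) k by simp
  also have "same_curve (n + k) (past_center (ancestor n k f)) (ancestor n k f)"
    using same_curve_past_center[of "ancestor n k f" "n + k"] assms(2) equivclp_sym by simp
  finally have "same_curve (n + k) (ancestor n k e) (ancestor n k f)" .
  then show "same_curve n e f" using assms by (rule same_curve_if_ancestors)
qed

lemma past_center_east_west [simp]: "past_center east = east" "past_center west = west"
  by (simp_all add: past_center_def zero_prod_def)

lemma not_same_curve_east_west: "\<not> same_curve n east west"
  by (simp add: same_curve_iff_ancestors_meet)

subsection \<open>Large disks on a single curve\<close>

lemma ancestor_five: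
  "ancestor n 5 e = parent (\<alpha> (n + 4)) (parent (\<alpha> (n + 3)) (parent (\<alpha> (n + 2))
    (parent (\<alpha> (n + 1)) (parent (\<alpha> n) e))))"
  by (simp add: eval_nat_numeral)

lemma square_merges_into_east:
  obtains j k v where "even_point v"
    "\<And>e. e \<in> square_arrows \<Longrightarrow> ancestor (n + j) k (shift v (ancestor n j e)) = east"
proof (cases "\<exists>j. \<alpha> (n + j) = \<alpha> (Suc (n + j))")
  case True
  then obtain j where j: "\<alpha> (n + j) = \<alpha> (Suc (n + j))" by blast
  have center: "ancestor n (Suc (Suc j)) e \<in> center_arrows" if "e \<in> square_arrows" for e
    using ancestor_in_center_if_repeated[OF _ j] ancestor_in_square_mono[of n 0 e j] that by simp
  let ?m = "n + Suc (Suc j)"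
  obtain v where "even_point v" "\<And>e. e \<in> center_arrows \<Longrightarrow> ancestor ?m 5 (shift v e) = east"
    unfolding ancestor_five
    using center_shift_descends_from_east[OF sign_letter[of ?m] sign_letter[of "?m + 1"]
      sign_letter[of "?m + 2"] sign_letter[of "?m + 3"] sign_letter[of "?m + 4"]] by blast
  with center show ?thesis using that[of v "Suc (Suc j)" 5] by blast
next
  case False
  have "\<alpha> (Suc (n + i)) = - \<alpha> (n + i)" for i
    using False sign_letter[of "n + i"] sign_letter[of "Suc (n + i)"] by (metis minus_minus)
  from this[of 0] this[of 1] this[of 2] this[of 3]
  have "\<alpha> (n + 1) = - \<alpha> n" "\<alpha> (n + 2) = \<alpha> n" "\<alpha> (n + 3) = - \<alpha> n" "\<alpha> (n + 4) = \<alpha> n"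
    by (simp_all add: eval_nat_numeral)
  then have "ancestor (n + 0) 5 (shift (4, 2 * \<alpha> n) (ancestor n 0 e)) = east"
    if "e \<in> square_arrows" for e
    using square_shift_descends_from_east[OF sign_letter that, of n] by (simp add: ancestor_five)
  moreover have "even_point (4, 2 * \<alpha> n)" by simp
  ultimately show ?thesis using that by blast
qed

lemma curve_of_east_contains_disk:
  obtains v where "\<And>e. is_arrow e \<Longrightarrow> sqnorm (fst e - v) \<le> r \<Longrightarrow> same_curve 0 e east"
proof -
  let ?B = "{e. is_arrow e \<and> sqnorm (fst e) \<le> r}"
  have "\<forall>\<^sub>F k in sequentially. \<forall>e\<in>?B. ancestor 0 k e \<in> square_arrows"
    using ancestor_eventually_in_square by (intro eventually_ball_finite finite_arrows_near) blast
  then obtain n where n: "\<And>e. e \<in> ?B \<Longrightarrow> ancestor 0 n e \<in> square_arrows"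
    unfolding eventually_sequentially by blast
  obtain j k u where u: "even_point u"
    and merge: "\<And>e. e \<in> square_arrows \<Longrightarrow> ancestor (n + j) k (shift u (ancestor n j e)) = east"
    using square_merges_into_east by metis
  define v where "v = multiplier 0 (n + j) \<odot> u"
  have "same_curve 0 e east" if e: "is_arrow e" "sqnorm (fst e - v) \<le> r" for e
  proof -
    define f where "f = shift (- v) e"
    have "even_point v" unfolding v_def using u by (simp add: even_point_multiplier)
    then have "ancestor 0 n f \<in> square_arrows" using n e by (simp add: f_def is_arrow_shift)
    have "e = shift v f" by (simp add: f_def prod_eq_iff)
    then have "ancestor 0 (n + j) e = ancestor 0 (n + j) (shift v f)" by (rule arg_cong)
    also have "\<dots> = shift u (ancestor n j (ancestor 0 n f))"
      unfolding v_def ancestor_shift[OF u] by (simp add: ancestor_add)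
    finally have "ancestor (n + j) k (ancestor 0 (n + j) e) = east"
      using merge[OF \<open>ancestor 0 n f \<in> square_arrows\<close>] by simp
    then have "ancestor 0 (n + j + k) e = ancestor 0 (n + j + k) east" by (simp add: ancestor_add)
    then show ?thesis using same_curve_if_ancestors[of 0 "n + j + k" e east] e(1) by simp
  qed
  then show ?thesis using that by blast
qed

subsection \<open>Repeated and alternating letters\<close>

lemma same_curve_if_ancestor_center:
  assumes "is_arrow e" "ancestor n k e \<in> center_arrows"
  shows "same_curve n e east \<or> same_curve n e west"
proof -
  have "same_curve (n + k) (ancestor n k e) (past_center (ancestor n k e))"
    using same_curve_past_center[of "ancestor n k e"] assms(1) by simp
  then show ?thesis
    using past_center_eq_center[OF assms(2)] assms(1) same_curve_if_ancestors[of n k e east]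
      same_curve_if_ancestors[of n k e west] by auto
qed

definition alternating_from :: "nat \<Rightarrow> bool" where
  "alternating_from n \<longleftrightarrow> (\<forall>m\<ge>n. \<alpha> (Suc m) = - \<alpha> m)"

lemma same_curve_if_never_alternating:
  assumes "\<And>n. \<not> alternating_from n" "is_arrow e"
  shows "same_curve 0 e east \<or> same_curve 0 e west"
proof -
  obtain m where m: "\<And>k. k \<ge> m \<Longrightarrow> ancestor 0 k e \<in> square_arrows"
    using ancestor_eventually_in_square[OF assms(2)] unfolding eventually_sequentially by blast
  obtain k where k: "k \<ge> m" "\<alpha> (Suc k) \<noteq> - \<alpha> k"
    using assms(1) unfolding alternating_from_def by blast
  then have "\<alpha> k = \<alpha> (Suc k)" using sign_letter[of k] sign_letter[of "Suc k"] by (metis minus_minus)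
  with k(1) have "ancestor 0 (Suc (Suc k)) e \<in> center_arrows"
    using ancestor_in_center_if_repeated[OF m] by simp
  then show ?thesis by (rule same_curve_if_ancestor_center[OF assms(2)])
qed

lemma ancestor_survivors:
  assumes "alternating_from n"
  shows "bij_betw (ancestor n k) (survivors (\<alpha> n)) (survivors (\<alpha> (n + k)))"
proof (induction k)
  case 0
  then show ?case by (simp add: bij_betw_def inj_on_def)
next
  case (Suc k)
  have "bij_betw (parent (\<alpha> (n + k)) \<circ> ancestor n k)
      (survivors (\<alpha> n)) (survivors (\<alpha> (Suc (n + k))))"
    using bij_betw_trans[OF Suc parent_survivors] assms by (simp add: alternating_from_def)
  then show ?case by (simp add: comp_def)
qed

lemma past_center_survivor:
  assumes "e \<in> survivors c"
  shows "past_center e = e"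
proof -
  have "e \<in> square_arrows" "e \<notin> center_arrows" using assms survivors_subset by blast+
  then have "snd e \<noteq> 0" using center_arrows_iff[OF is_arrow_square] by blast
  then show ?thesis by (simp add: past_center_def)
qed

lemma ancestor_remains_survivor:
  assumes "alternating_from n" "ancestor 0 n e \<in> survivors (\<alpha> n)"
  shows "ancestor 0 (n + k) e \<in> survivors (\<alpha> (n + k))"
  using bij_betwE[OF ancestor_survivors[OF assms(1)]] assms(2) by (simp add: ancestor_add)

lemma same_curve_meet_after:
  assumes "same_curve 0 e f" "is_arrow e"
  obtains k where "past_center (ancestor 0 (n + k) e) = past_center (ancestor 0 (n + k) f)"
proof -
  have "is_arrow f" using assms by (rule same_curve_arrow)
  then obtain k where "past_center (ancestor 0 k e) = past_center (ancestor 0 k f)"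
    using assms same_curve_iff_ancestors_meet[OF assms(2)] by blast
  then have "past_center (ancestor 0 (n + k) e) = past_center (ancestor 0 (n + k) f)"
    using past_center_ancestor_mono[OF _ _ assms(2) \<open>is_arrow f\<close>] le_add2 by blast
  then show ?thesis using that by blast
qed

lemma same_curve_survivors_iff:
  assumes alt: "alternating_from n"
    and e: "is_arrow e" "ancestor 0 n e \<in> survivors (\<alpha> n)"
    and f: "is_arrow f" "ancestor 0 n f \<in> survivors (\<alpha> n)"
  shows "same_curve 0 e f \<longleftrightarrow> ancestor 0 n e = ancestor 0 n f"
proof
  assume "same_curve 0 e f"
  then obtain k where k: "past_center (ancestor 0 (n + k) e) = past_center (ancestor 0 (n + k) f)"
    using same_curve_meet_after e(1) by blast
  then have "ancestor 0 (n + k) e = ancestor 0 (n + k) f"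
    using past_center_survivor[OF ancestor_remains_survivor[OF alt e(2)]]
      past_center_survivor[OF ancestor_remains_survivor[OF alt f(2)]] by simp
  then have "ancestor n k (ancestor 0 n e) = ancestor n k (ancestor 0 n f)"
    by (simp add: ancestor_add)
  then show "ancestor 0 n e = ancestor 0 n f"
    using ancestor_survivors[OF alt] e(2) f(2) by (meson bij_betw_def inj_onD)
next
  assume "ancestor 0 n e = ancestor 0 n f"
  then show "same_curve 0 e f" using same_curve_if_ancestors[of 0 n e f] e(1) f(1) by simp
qed

lemma not_same_curve_survivor_center:
  assumes "alternating_from n" "is_arrow e" "ancestor 0 n e \<in> survivors (\<alpha> n)"
    and f: "f \<in> center_arrows"
  shows "\<not> same_curve 0 e f"
proof
  assume "same_curve 0 e f"
  then obtain k where "past_center (ancestor 0 (n + k) e) = past_center (ancestor 0 (n + k) f)"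
    using same_curve_meet_after assms(2) by blast
  moreover have survivor: "ancestor 0 (n + k) e \<in> survivors (\<alpha> (n + k))"
    using assms(1,3) by (rule ancestor_remains_survivor)
  ultimately have "ancestor 0 (n + k) e \<in> {east, west}"
    using past_center_survivor[OF survivor] past_center_eq_center[OF f] f by simp
  moreover have "ancestor 0 (n + k) e \<notin> center_arrows" using survivor survivors_subset by blast
  ultimately show False using east_west_arrows(1,2) by auto
qed

lemma same_curve_survivor_cases:
  assumes "alternating_from n" "is_arrow e"
  obtains (east) "same_curve 0 e east" | (west) "same_curve 0 e west"
  | (survivor) f where "f \<in> survivors (\<alpha> n)"
      "\<And>g. is_arrow g \<Longrightarrow> ancestor 0 n g = f \<Longrightarrow> same_curve 0 e g"
proof -
  obtain m where m: "\<And>k. k \<ge> m \<Longrightarrow> ancestor 0 k e \<in> square_arrows"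
    using ancestor_eventually_in_square[OF assms(2)] unfolding eventually_sequentially by blast
  show ?thesis
  proof (cases "ancestor 0 (n + m) e \<in> survivors (\<alpha> (n + m))")
    case True
    then obtain f where f: "f \<in> survivors (\<alpha> n)" "ancestor n m f = ancestor 0 (n + m) e"
      using bij_betw_imp_surj_on[OF ancestor_survivors[OF assms(1)]] by (metis imageE)
    have "same_curve 0 e g" if "is_arrow g" "ancestor 0 n g = f" for g
    proof (rule same_curve_if_ancestors[of _ "n + m"])
      have "ancestor 0 (n + m) g = ancestor 0 (n + m) e"
        using that(2) f(2) by (simp add: ancestor_add)
      then show "same_curve (0 + (n + m)) (ancestor 0 (n + m) e) (ancestor 0 (n + m) g)" by simp
    qed (rule assms(2) that(1))+
    with f(1) survivor show ?thesis by blast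
  next
    case False
    then have "ancestor 0 (Suc (n + m)) e \<in> center_arrows"
      using parent_not_survivor[OF sign_letter m] by simp
    then show ?thesis using same_curve_if_ancestor_center[OF assms(2)] east west by blast
  qed
qed

subsection \<open>Walks through the center\<close>

definition toeplitz :: "nat \<Rightarrow> (int \<Rightarrow> int) \<Rightarrow> bool" where
  "toeplitz n s \<longleftrightarrow> s 0 = \<epsilon> \<and> (\<forall>m k. s (2 ^ m * (2 * k + 1)) = parity_sign k * \<alpha> (n + m))"

lemma toeplitz_odd: "toeplitz n s \<Longrightarrow> s (2 * k + 1) = parity_sign k * \<alpha> n"
  unfolding toeplitz_def by (metis add.right_neutral mult_1 power_0)

lemma toeplitz_even: "toeplitz n s \<Longrightarrow> toeplitz (Suc n) (\<lambda>h. s (2 * h))"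
  unfolding toeplitz_def by (metis add_Suc_shift mult.assoc mult_zero_right power_Suc)

lemma toeplitz_change:
  assumes "toeplitz n s" "odd i"
  shows "s (2 * (i + 2)) \<noteq> s (2 * i)"
proof -
  obtain k where i: "i = 2 * k + 1" using assms(2) by (elim oddE)
  have "s (2 * (2 * k + 1)) = parity_sign k * \<alpha> (Suc n)"
    "s (2 * (2 * (k + 1) + 1)) = - (parity_sign k * \<alpha> (Suc n))"
    using toeplitz_odd[OF toeplitz_even[OF assms(1)], of k]
      toeplitz_odd[OF toeplitz_even[OF assms(1)], of "k + 1"] by simp_all
  moreover have "i + 2 = 2 * (k + 1) + 1" by (simp add: i)
  ultimately show ?thesis
    unfolding i by simp
qed

lemma toeplitz_recognizable:
  assumes "toeplitz n s" "\<And>h. 0 \<le> h \<Longrightarrow> h \<le> 8 * 2 ^ m \<Longrightarrow> s (j + h) = s h"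
  shows "2 ^ m dvd j"
  using assms
proof (induction m arbitrary: n s j)
  case (Suc m)
  have long: "(8::int) \<le> 8 * 2 ^ Suc m" using one_le_power[of "2::int" "Suc m"] by simp
  have "even j"
  proof (rule ccontr)
    assume "odd j"
    then obtain i where j: "j = 2 * i + 1" by (elim oddE)
    have shifted: "s (2 * (i + 1 + l)) = parity_sign l * \<alpha> n" if "0 \<le> l" "l \<le> 3" for l
      using Suc.prems(2)[of "2 * l + 1"] toeplitz_odd[OF Suc.prems(1), of l] that long j
      by (simp add: algebra_simps)
    define l :: int where "l = (if even i then 0 else 1)"
    have "s (2 * (i + 1 + (l + 2))) = s (2 * (i + 1 + l))"
      using shifted[of l] shifted[of "l + 2"] by (simp add: l_def parity_sign_def)
    moreover have "odd (i + 1 + l)" by (simp add: l_def)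
    ultimately show False
      using toeplitz_change[OF Suc.prems(1), of "i + 1 + l"] by (simp add: add.assoc)
  qed
  then obtain i where j: "j = 2 * i" by (elim evenE)
  have "2 ^ m dvd i"
  proof (rule Suc.IH[OF toeplitz_even[OF Suc.prems(1)]])
    fix h :: int assume "0 \<le> h" "h \<le> 8 * 2 ^ m"
    then show "s (2 * (i + h)) = s (2 * h)"
      using Suc.prems(2)[of "2 * h"] by (simp add: j algebra_simps)
  qed
  then show ?case by (simp add: j)
qed simp

lemma walk_derivative:
  assumes "walk s w" "even_point (snd (w 0))" "\<And>k. s (2 * k + 1) = turn n (snd (w (2 * k + 1)))"
  shows "walk (\<lambda>h. s (2 * h)) (\<lambda>h. parent (\<alpha> n) (w (2 * h)))"
    and "snd (w (2 * h)) = (1, \<alpha> n) \<odot> snd (parent (\<alpha> n) (w (2 * h)))"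
proof -
  have even: "even_point (snd (w (2 * k)))" for k
    using walk_parity[OF assms(1), of "2 * k"] assms(2) by simp
  then show "snd (w (2 * h)) = (1, \<alpha> n) \<odot> snd (parent (\<alpha> n) (w (2 * h)))"
    using parent_successor(3) walkD(1)[OF assms(1)] by blast
  have "parent (\<alpha> n) (w (2 * (k + 1))) = turn_by (s (2 * k)) (parent (\<alpha> n) (w (2 * k)))" for k
  proof -
    define q where "q = parent (\<alpha> n) (w (2 * k))"
    have q: "is_arrow q" using walkD(1)[OF assms(1)] by (simp add: q_def is_arrow_parent)
    have "\<not> even_point (fst (w (2 * k)))"
      using even even_snd_arrow[OF walkD(1)[OF assms(1)]] by blast
    then have "w (2 * k) = second_child (\<alpha> n) q"
      using children_parent(2)[OF sign_letter walkD(1)[OF assms(1)]] by (simp add: q_def)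
    then have first: "w (2 * k + 1) = first_child (\<alpha> n) (turn_by (s (2 * k)) q)"
      using walkD(3)[OF assms(1), of "2 * k"] q by (simp add: first_child_turn_by)
    have "w (2 * (k + 1)) = successor n (w (2 * k + 1))"
      using walkD(3)[OF assms(1), of "2 * k + 1"] assms(3)[of k]
      by (simp add: successor_def algebra_simps)
    moreover have "\<not> even_point (snd (w (2 * k + 1)))"
      using walk_parity[OF assms(1), of "2 * k + 1"] assms(2) by simp
    ultimately have "parent (\<alpha> n) (w (2 * (k + 1))) = parent (\<alpha> n) (w (2 * k + 1))"
      using parent_successor(1)[OF walkD(1)[OF assms(1)], of "2 * k + 1" n] by simp
    also have "\<dots> = turn_by (s (2 * k)) q"
      unfolding first
      using is_arrow_turn_by[OF is_arrow_imp_segment[OF q] walkD(2)[OF assms(1)]] q by simp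
    finally show ?thesis by (simp add: q_def)
  qed
  then show "walk (\<lambda>h. s (2 * h)) (\<lambda>h. parent (\<alpha> n) (w (2 * h)))"
    using walkD(1,2)[OF assms(1)] by (simp add: walk_def is_arrow_parent)
qed

lemma walk_through_center_odd_turn:
  assumes "walk s w" "snd (w 0) = 0"
  shows "turn n (snd (w (2 * k + 1))) = parity_sign k * \<alpha> n"
proof -
  have even: "even_point (snd (w 0))" using assms(2) by simp
  then have "\<not> even_point (snd (w (2 * k + 1)))"
    using walk_parity[OF assms(1), of "2 * k + 1"] by simp
  moreover have "parity_sign (snd (snd (w (2 * k + 1)))) = parity_sign k"
    using walk_parity_sign_odd[OF assms(1) even, of k] assms(2) by (simp add: parity_sign_def)
  ultimately show ?thesis by (simp add: turn_odd corner_turn_def)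
qed

text \<open>With \<open>s = t\<close> this applies to walks with prescribed turns, and with \<open>s\<close> given by the turn
  function to walks that follow it.\<close>

lemma walk_through_center_turn:
  assumes "walk s w" "snd (w 0) = 0" "toeplitz n t" "\<And>h. s h = t h \<or> s h = turn n (snd (w h))"
  shows "turn n (snd (w h)) = t h"
  using assms
proof (induction "nat \<bar>h\<bar>" arbitrary: h n s t w rule: less_induct)
  case less
  have even: "even_point (snd (w 0))" using less.prems(2) by simp
  have odd: "turn n (snd (w (2 * k + 1))) = t (2 * k + 1)" for k
    using walk_through_center_odd_turn[OF less.prems(1,2), of n k]
      toeplitz_odd[OF less.prems(3), of k] by simp
  consider k where "h = 2 * k + 1" | "h = 0" | k where "h = 2 * k" "h \<noteq> 0"
    by (metis evenE oddE)
  then show ?case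
  proof cases
    case 1
    then show ?thesis using odd by simp
  next
    case 2
    then show ?thesis using less.prems(2,3) by (simp add: toeplitz_def)
  next
    case 3
    have "s (2 * k + 1) = turn n (snd (w (2 * k + 1)))" for k
      using less.prems(4)[of "2 * k + 1"] odd[of k] by auto
    note derivative = walk_derivative[OF less.prems(1) even this]
    have "turn (Suc n) (snd (parent (\<alpha> n) (w (2 * k)))) = t (2 * k)"
    proof (rule less.hyps[OF _ derivative(1) _ toeplitz_even[OF less.prems(3)]])
      show "nat \<bar>k\<bar> < nat \<bar>h\<bar>" using 3 by simp
      show "snd (parent (\<alpha> n) (w (2 * 0))) = 0"
        using derivative(2)[of 0] less.prems(2) by simp
      show "s (2 * h) = t (2 * h) \<or> s (2 * h) = turn (Suc n) (snd (parent (\<alpha> n) (w (2 * h))))" for h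
        using less.prems(4)[of "2 * h"] derivative(2)[of h] by simp
    qed
    then show ?thesis using derivative(2)[of k] 3(1) by simp
  qed
qed

lemma walk_through_center_if_toeplitz:
  assumes "walk s w" "toeplitz n s" "\<And>h. turn n (snd (w h)) = s h"
  shows "snd (w 0) = 0"
  using assms
proof (induction "nat (sqnorm (snd (w 0)))" arbitrary: n s w rule: less_induct)
  case less
  show ?case
  proof (cases "even_point (snd (w 0))")
    case False
    have odd: "\<not> even_point (snd (w (2 * k)))" for k
      using walk_parity[OF less.prems(1), of "2 * k"] False by simp
    have "s (2 * k) = parity_sign k * (\<alpha> n * parity_sign (snd (snd (w 0))))" for k
      using less.prems(3)[of "2 * k"] turn_odd[OF odd[of k], of n]
        walk_parity_sign[OF less.prems(1), of 0 k] by (simp add: corner_turn_def mult.left_commute)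
    from this[of 1] this[of 3] have "s (2 * (1 + 2)) = s (2 * 1)" by (simp add: parity_sign_def)
    then show ?thesis using toeplitz_change[OF less.prems(2), of 1] by simp
  next
    case True
    note derivative = walk_derivative[OF less.prems(1) True less.prems(3)[symmetric]]
    define p where "p = snd (parent (\<alpha> n) (w (2 * 0)))"
    have p: "snd (w 0) = (1, \<alpha> n) \<odot> p" using derivative(2)[of 0] by (simp add: p_def)
    have "p = 0" if "p \<noteq> 0"
      unfolding p_def
    proof (rule less.hyps[OF _ derivative(1) toeplitz_even[OF less.prems(2)]])
      have "sqnorm p > 0" using that by (rule sqnorm_pos)
      then show "nat (sqnorm (snd (parent (\<alpha> n) (w (2 * 0))))) < nat (sqnorm (snd (w 0)))"
        unfolding p_def[symmetric] p by (simp add: sqnorm_one_plus)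
      show "turn (Suc n) (snd (parent (\<alpha> n) (w (2 * h)))) = s (2 * h)" for h
        using less.prems(3)[of "2 * h"] derivative(2)[of h] by simp
    qed
    then show ?thesis using p by auto
  qed
qed

lemma walk_through_center_multiplier:
  assumes "walk s w" "snd (w 0) = 0" "toeplitz n s"
  obtains p where "snd (w (2 ^ k * i)) = multiplier n k \<odot> p"
proof -
  have "\<exists>p. snd (w (2 ^ k * i)) = multiplier n k \<odot> p"
    using assms
  proof (induction k arbitrary: n s w)
    case (Suc k)
    have even: "even_point (snd (w 0))" using Suc.prems(2) by simp
    have turns: "s h = turn n (snd (w h))" for h
      using walk_through_center_turn[OF Suc.prems] by simp
    note derivative = walk_derivative[OF Suc.prems(1) even turns]
    have "snd (parent (\<alpha> n) (w (2 * 0))) = 0"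
      using derivative(2)[of 0] Suc.prems(2) by simp
    then obtain p where "snd (parent (\<alpha> n) (w (2 * (2 ^ k * i)))) = multiplier (Suc n) k \<odot> p"
      using Suc.IH[OF derivative(1) _ toeplitz_even[OF Suc.prems(3)]] by auto
    then have "snd (w (2 ^ Suc k * i)) = multiplier n (Suc k) \<odot> p"
      using derivative(2)[of "2 ^ k * i"] by (simp add: mult.assoc gmult_assoc)
    then show ?case by blast
  qed simp
  then show ?thesis using that by blast
qed

definition trajectory :: "nat \<Rightarrow> (int \<Rightarrow> segment) \<Rightarrow> bool" where
  "trajectory n w \<longleftrightarrow> (\<forall>h. is_arrow (w h) \<and> w (h + 1) = successor n (w h))"

lemma trajectory_iff_walk: "trajectory n w \<longleftrightarrow> walk (\<lambda>h. turn n (snd (w h))) w"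
  by (simp add: trajectory_def walk_def successor_def)

lemma trajectoryD:
  assumes "trajectory n w"
  shows "is_arrow (w h)" "w (h + 1) = successor n (w h)"
  using assms by (auto simp: trajectory_def)

lemma same_curve_trajectory_iff:
  assumes "trajectory n w"
  shows "same_curve n (w i) f \<longleftrightarrow> f \<in> range w"
proof
  note succ = trajectoryD(2)[OF assms]
  show "f \<in> range w" if "same_curve n (w i) f"
    using that
  proof (induction rule: equivclp_induct)
    case (step g h)
    then obtain j where "g = w j" by blast
    then consider "h = w (j + 1)" | "successor n h = successor n (w (j - 1))"
      using step.hyps(2) succ[of j] succ[of "j - 1"] by auto
    then show ?case using successor_inject by cases blast+
  qed simp
  have adjacent: "same_curve n (w j) (w (j + 1))" for j
    using same_curve_successor[of "w j" n] trajectoryD[OF assms] by simp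
  have "same_curve n (w i) (w j)" for j
  proof (induction j rule: int_induct[of _ i])
    case (step1 j)
    show ?case using step1(2) adjacent[of j] by (rule equivclp_trans)
  next
    case (step2 j)
    have "same_curve n (w j) (w (j - 1))" using equivclp_sym[OF adjacent[of "j - 1"]] by simp
    with step2(2) show ?case by (rule equivclp_trans)
  qed simp
  then show "same_curve n (w i) f" if "f \<in> range w" using that by blast
qed

end

subsection \<open>Folding sequences\<close>

lemma length_folding: "folding n S \<Longrightarrow> length S = 2 ^ n - 1"
proof (induction rule: folding.induct)
  case (folding_Suc n S e)
  then show ?case using one_le_power[of "2::nat" n] by (simp add: bar_def)
qed simp

lemma set_folding: "folding n S \<Longrightarrow> set S \<subseteq> {1, -1}"
  by (induction rule: folding.induct) (auto simp: bar_def)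

lemma is_sign_infinite_folding_seq:
  assumes "infinite_folding_seq a" "h \<ge> 1"
  shows "is_sign (a h)"
proof -
  have "folding h (map a [1..<2 ^ h])" using assms by (simp add: infinite_folding_seq_def)
  moreover have "h < 2 ^ h" by (rule less_exp)
  ultimately show ?thesis using set_folding assms(2) by fastforce
qed

lemma nth_folding_reflect:
  assumes "folding (Suc n) T" "i < 2 ^ n - 1"
  shows "T ! (2 ^ Suc n - 2 - i) = - (T ! i)"
proof -
  obtain S e where S: "folding n S" "T = bar S @ [e] @ S"
    using assms(1) by (cases rule: folding.cases) auto
  have len: "length S = 2 ^ n - 1" using length_folding[OF S(1)] .
  then have bar: "length (bar S) = 2 ^ n - 1" by (simp add: bar_def)
  have "2 ^ Suc n - 2 - i = length (bar S @ [e]) + (2 ^ n - 2 - i)" using assms(2) bar by simp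
  then have "T ! (2 ^ Suc n - 2 - i) = S ! (2 ^ n - 2 - i)"
    unfolding S(2) append_assoc[symmetric] by (simp only: nth_append_length_plus)
  moreover have "T ! i = - (S ! (2 ^ n - 2 - i))"
    using assms(2) len by (simp add: S(2) nth_append bar_def rev_nth)
  ultimately show ?thesis by simp
qed

lemma infinite_folding_seq_reflect:
  assumes "infinite_folding_seq a" "0 < j" "j < 2 ^ n"
  shows "a (2 ^ n + j) = - a (2 ^ n - j)"
proof -
  let ?T = "map a [1..<2 ^ Suc n]"
  have "folding (Suc n) ?T" using assms(1) by (simp add: infinite_folding_seq_def del: power_Suc)
  then have "?T ! (2 ^ Suc n - 2 - (2 ^ n - j - 1)) = - (?T ! (2 ^ n - j - 1))"
    using assms(2,3) by (intro nth_folding_reflect) linarith+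
  moreover have "2 ^ Suc n - 2 - (2 ^ n - j - 1) = 2 ^ n + j - 1" using assms(2,3) by simp
  ultimately show ?thesis using assms(2,3) by (simp add: Suc_diff_Suc)
qed

lemma infinite_folding_seq_odd_multiple:
  assumes "infinite_folding_seq a"
  shows "a (2 ^ m * (2 * k + 1)) = parity_sign (int k) * a (2 ^ m)"
proof (induction k rule: less_induct)
  case (less k)
  show ?case
  proof (cases "k = 0")
    case False
    obtain N where N: "2 ^ N \<le> 2 * k + 1" "2 * k + 1 < 2 ^ Suc N"
      using ex_power_ivl1[of 2 "2 * k + 1"] by auto
    then obtain M where M: "N = Suc M" using False by (cases N) auto
    define k' where "k' = 2 ^ N - k - 1"
    have "2 ^ M \<le> k" "k < 2 * 2 ^ M" using N unfolding M by auto
    then have k': "k' < k" "k' + k + 1 = 2 ^ N" unfolding k'_def M using False by auto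
    have "2 * k + 1 = 2 ^ N + (k - k')" "2 * k' + 1 = 2 ^ N - (k - k')" using k' by linarith+
    then have "2 ^ m * (2 * k + 1) = 2 ^ (m + N) + 2 ^ m * (k - k')"
      "2 ^ m * (2 * k' + 1) = 2 ^ (m + N) - 2 ^ m * (k - k')"
      by (simp_all only: power_add distrib_left diff_mult_distrib2)
    moreover have "0 < 2 ^ m * (k - k')" "2 ^ m * (k - k') < 2 ^ (m + N)"
      using k' by (auto simp: power_add)
    ultimately have "a (2 ^ m * (2 * k + 1)) = - a (2 ^ m * (2 * k' + 1))"
      using infinite_folding_seq_reflect[OF assms] by metis
    moreover have "even k' \<longleftrightarrow> odd k"
      using k'(2) M by (metis dvd_triv_left even_add even_plus_one_iff power_Suc)
    ultimately show ?thesis using less.IH[OF k'(1)] by (auto simp: parity_sign_def)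
  qed (simp add: parity_sign_def)
qed

lemma two_sided_minus: "h \<noteq> 0 \<Longrightarrow> two_sided a e (- h) = - two_sided a e h"
  by (simp add: two_sided_def)

lemma folding_plane_infinite_folding_seq:
  assumes "infinite_folding_seq a" "is_sign \<epsilon>"
  shows "folding_plane (\<lambda>n. a (2 ^ n)) \<epsilon>"
  using is_sign_infinite_folding_seq[OF assms(1)] assms(2) by unfold_locales auto

lemma toeplitz_two_sided:
  assumes "infinite_folding_seq a" "is_sign \<epsilon>"
  shows "folding_plane.toeplitz (\<lambda>n. a (2 ^ n)) \<epsilon> 0 (two_sided a \<epsilon>)"
proof -
  interpret folding_plane "\<lambda>n. a (2 ^ n)" \<epsilon> using assms by (rule folding_plane_infinite_folding_seq)
  have nonneg: "two_sided a \<epsilon> (2 ^ m * (2 * int k + 1)) = parity_sign (int k) * a (2 ^ m)" for m k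
  proof -
    have "2 ^ m * (2 * int k + 1) = int (2 ^ m * (2 * k + 1))" by (simp add: algebra_simps)
    then show ?thesis
      unfolding two_sided_def using infinite_folding_seq_odd_multiple[OF assms(1), of m k]
      by (simp del: of_nat_mult of_nat_power of_nat_add)
  qed
  have "two_sided a \<epsilon> (2 ^ m * (2 * k + 1)) = parity_sign k * a (2 ^ m)" for m k
  proof (cases "k \<ge> 0")
    case True
    then show ?thesis using nonneg[of m "nat k"] by simp
  next
    case False
    define l where "l = nat (- k - 1)"
    have k: "k = - int l - 1" using False by (simp add: l_def)
    have "2 ^ m * (2 * k + 1) = - (2 ^ m * (2 * int l + 1))" by (simp add: k algebra_simps)
    moreover have "2 ^ m * (2 * int l + 1) \<noteq> 0" by simp
    ultimately show ?thesis
      using nonneg[of m l] two_sided_minus[of "2 ^ m * (2 * int l + 1)" a \<epsilon>]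
      by (simp add: k parity_sign_def)
  qed
  then show ?thesis by (simp add: toeplitz_def) (simp add: two_sided_def)
qed

lemma eventually_alternating_iff:
  fixes \<alpha> :: "nat \<Rightarrow> int"
  assumes "\<And>n. is_sign (\<alpha> n)"
  shows "finite {n. \<alpha> n = (-1) ^ n} \<or> finite (- {n. \<alpha> n = (-1) ^ n}) \<longleftrightarrow>
    (\<exists>N. \<forall>m\<ge>N. \<alpha> (Suc m) = - \<alpha> m)" (is "?finite \<longleftrightarrow> ?alternating")
proof
  assume ?finite
  then obtain N where N: "(\<forall>n\<ge>N. \<alpha> n \<noteq> (-1) ^ n) \<or> (\<forall>n\<ge>N. \<alpha> n = (-1) ^ n)"
    unfolding finite_nat_set_iff_bounded by (auto simp: not_less[symmetric])
  have "\<alpha> (Suc m) = - \<alpha> m" if "m \<ge> N" for m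
  proof -
    have "\<alpha> m = (-1) ^ m \<longleftrightarrow> \<alpha> (Suc m) = (-1) ^ Suc m" using N that le_SucI by blast
    then show ?thesis using assms[of m] assms[of "Suc m"] by (cases "even m") auto
  qed
  then show ?alternating by blast
next
  assume ?alternating
  then obtain N where N: "\<And>m. m \<ge> N \<Longrightarrow> \<alpha> (Suc m) = - \<alpha> m" by blast
  have "\<alpha> n = (-1) ^ n \<longleftrightarrow> \<alpha> N = (-1) ^ N" if "n \<ge> N" for n
    using that by (induction n rule: dec_induct) (auto simp: N)
  then have "{n. \<alpha> n = (-1) ^ n} \<subseteq> {..<N} \<or> - {n. \<alpha> n = (-1) ^ n} \<subseteq> {..<N}"
    by (metis (mono_tags, lifting) ComplD lessThan_iff linorder_not_less mem_Collect_eq subsetI)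
  then show ?finite using finite_subset finite_lessThan by blast
qed

subsection \<open>Placing arrows in the plane\<close>

abbreviation real_point :: "point \<Rightarrow> real \<times> real" where
  "real_point \<equiv> \<lambda>(x, y). (real_of_int x, real_of_int y)"

lemma dist_real_point: "dist (real_point p) (real_point q) = sqrt (real_of_int (sqnorm (p - q)))"
  by (cases p; cases q) (simp add: dist_Pair_Pair dist_real_def sqnorm_def)

locale placement =
  fixes origin unit :: point
  assumes sqnorm_unit: "sqnorm unit = 1"
begin

definition embed :: "point \<Rightarrow> point" where
  "embed p = origin + unit \<odot> p"

definition place :: "segment \<Rightarrow> segment" where
  "place = map_prod embed embed"

lemma embed_diff: "embed p - embed q = unit \<odot> (p - q)"
  by (simp add: embed_def gmult_diff_right)

lemma bij_embed: "bij embed"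
proof (rule bijI)
  have "unit \<noteq> 0" using sqnorm_unit by auto
  then show "inj embed" by (intro injI) (simp add: embed_def gmult_left_cancel)
  have "embed (gconj unit \<odot> (p - origin)) = p" for p
    by (simp add: embed_def gmult_gconj sqnorm_unit flip: gmult_assoc)
  then show "surj embed" by (intro surjI[where f = "\<lambda>p. gconj unit \<odot> (p - origin)"])
qed

lemma embed_eq_iff: "embed p = embed q \<longleftrightarrow> p = q"
  using bij_embed by (simp add: bij_def inj_eq)

lemma bij_place: "bij place"
  unfolding place_def using bij_embed by (simp add: bij_def prod.inj_map map_prod_surj)

lemma place_eq_iff: "place c = place d \<longleftrightarrow> c = d"
  using bij_place by (simp add: bij_def inj_eq)

lemma fst_place [simp]: "fst (place c) = embed (fst c)"
  and snd_place [simp]: "snd (place c) = embed (snd c)"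
  by (simp_all add: place_def)

lemma dir_place: "dir (place c) = unit \<odot> dir c"
  by (simp add: dir_def embed_diff)

lemma is_segment_place: "is_segment (place c) \<longleftrightarrow> is_segment c"
  by (simp add: is_segment_iff_sqnorm dir_place sqnorm_gmult sqnorm_unit)

lemma turn_by_place: "turn_by t (place c) = place (turn_by t c)"
proof -
  have "(0, t) \<odot> (unit \<odot> dir c) = unit \<odot> ((0, t) \<odot> dir c)"
    by (metis gmult_assoc gmult_commute)
  then show ?thesis
    by (simp add: prod_eq_iff snd_turn_by dir_place embed_def gmult_add_right)
qed

lemma shift_place: "shift (unit \<odot> v) (place c) = place (shift v c)"
  by (simp add: prod_eq_iff embed_def gmult_add_right)

lemma support_place: "support (place c) = embed ` support c"
  by (simp add: support_def)

lemma support_place_eq_iff: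
  assumes "is_arrow e" "is_arrow f"
  shows "support (place e) = support (place f) \<longleftrightarrow> e = f"
  using arrow_eq_if_support_eq[OF assms] bij_is_inj[OF bij_embed]
  by (auto simp: support_place inj_image_eq_iff)

lemma arrow_with_support:
  assumes "is_segment c"
  obtains e where "is_arrow e" "support (place e) = support c"
proof -
  obtain d where d: "c = place d" using bij_place by (metis bij_pointE)
  then have "is_arrow d \<or> is_arrow (prod.swap d)"
    using assms arrow_or_swap by (simp add: is_segment_place)
  moreover have "support (place (prod.swap d)) = support c"
    by (simp add: d support_def insert_commute)
  ultimately show ?thesis using that d by blast
qed

lemma walk_inv_place:
  assumes "complete_curve C" "is_arrow e" "C i = place e"
  shows "walk (turns C) (inv place \<circ> C)"
proof -
  let ?w = "inv place \<circ> C"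
  have w: "place (?w h) = C h" for h using bij_place by (simp add: bij_is_surj surj_f_inv_f)
  then have segment: "is_segment (?w h)" for h
    using assms(1) is_segment_place[of "?w h"] by (simp add: complete_curve_def)
  have step: "?w (h + 1) = turn_by (turns C h) (?w h)" for h
    using complete_curve_turn_by[OF assms(1), of h] w[of h] w[of "h + 1"]
    by (metis place_eq_iff turn_by_place)
  have flip: "is_arrow (?w (h + 1)) \<longleftrightarrow> is_arrow (?w h)" for h
    unfolding step using is_arrow_turn_by[OF segment is_sign_turns] .
  have "is_arrow (?w h)" for h
  proof (induction h rule: int_induct[of _ i])
    case base
    have "?w i = e" using w[of i] assms(3) place_eq_iff by metis
    with assms(2) show ?case by simp
  next
    case (step1 h)
    then show ?case using flip by blast
  next
    case (step2 h)
    then show ?case using flip[of "h - 1"] by simp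
  qed
  with step show ?thesis by (simp add: walk_def is_sign_turns)
qed

end

lemma placement_of_segment:
  assumes "is_segment c"
  obtains origin unit where "placement unit" "c = placement.place origin unit east"
proof -
  have "sqnorm (dir c) = 1" using assms by (simp add: is_segment_iff_sqnorm)
  then interpret placement "fst c" "dir c" by unfold_locales
  have "dir c \<odot> (0, 0) = 0" "dir c \<odot> (1, 0) = dir c"
    by (cases "dir c"; simp add: zero_prod_def)+
  then have "c = place east" by (intro prod_eqI) (simp_all add: embed_def, simp_all add: dir_def)
  then show ?thesis using that[of "dir c" "fst c"] placement_axioms by blast
qed

subsection \<open>Curves of a covering\<close>

lemma equiv_shift_rel: "equiv UNIV shift_rel"
proof (rule equivI)
  show "refl shift_rel" by (auto simp: refl_on_def shift_rel_def intro: exI[of _ 0])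
  show "sym shift_rel"
  proof (rule symI)
    fix C D assume "(C, D) \<in> shift_rel"
    then obtain k where "D = (\<lambda>i. C (i + k))" by (auto simp: shift_rel_def)
    then have "C = (\<lambda>i. D (i + - k))" by simp
    then show "(D, C) \<in> shift_rel" unfolding shift_rel_def by blast
  qed
  show "trans shift_rel"
    by (rule transI) (auto simp: shift_rel_def add.assoc intro: exI[of _ "_ + _"])
qed simp_all

lemma curve_of_self: "C \<in> curve_of C"
  using equiv_class_self[OF equiv_shift_rel] by (simp add: curve_of_def)

lemma mem_curve_of_iff: "D \<in> curve_of C \<longleftrightarrow> (\<exists>k. D = (\<lambda>i. C (i + k)))"
  by (simp add: curve_of_def shift_rel_def)

lemma curve_of_eq: "D \<in> curve_of C \<Longrightarrow> curve_of D = curve_of C"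
  using equiv_class_eq[OF equiv_shift_rel] by (auto simp: curve_of_def)

lemma complete_curve_shift:
  assumes "complete_curve C"
  shows "complete_curve (\<lambda>i. C (i + k))"
proof -
  have "i + 1 + k = i + k + 1" for i by simp
  moreover have "inj (\<lambda>i. support (C (i + k)))"
    using assms unfolding complete_curve_def inj_def by (metis add_right_cancel)
  ultimately show ?thesis using assms unfolding complete_curve_def by metis
qed

lemma covering_member:
  assumes "folding_covering \<C>" "K \<in> \<C>" "D \<in> K"
  shows "complete_curve D" "K = curve_of D"
proof -
  have "K \<in> complete_folding_curves" using assms by (auto simp: folding_covering_def)
  then obtain C where C: "complete_curve C" "K = curve_of C"
    by (auto simp: complete_folding_curves_def quotient_def curve_of_def)
  then show "complete_curve D" using assms(3) complete_curve_shift by (auto simp: mem_curve_of_iff)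
  show "K = curve_of D" using C(2) assms(3) curve_of_eq by simp
qed

lemma covering_curve_nonempty:
  assumes "folding_covering \<C>" "K \<in> \<C>"
  obtains D where "D \<in> K"
proof -
  obtain C where "K = curve_of C"
    using assms
    by (auto simp: folding_covering_def complete_folding_curves_def quotient_def curve_of_def)
  then show ?thesis using that curve_of_self by blast
qed

lemma covering_curves_meet:
  assumes "folding_covering \<C>" "K \<in> \<C>" "K' \<in> \<C>" "D \<in> K" "D' \<in> K'" "support (D i) = support (D' j)"
  shows "K = K'" "D (i + h) = D' (j + h)"
proof -
  have "support (D i) \<in> unit_edges"
    using covering_member(1)[OF assms(1,2,4)] by (auto simp: unit_edges_def complete_curve_def)
  then have "\<exists>!x. case x of (K, c) \<Rightarrow> K \<in> \<C> \<and> c \<in> segments_of K \<and> support c = support (D i)"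
    using assms(1) by (simp add: folding_covering_def)
  moreover have "D i \<in> segments_of K" "D' j \<in> segments_of K'"
    using assms(4,5) by (auto simp: segments_of_def)
  ultimately have "(K, D i) = (K', D' j)"
    using assms(2,3,6) by (elim ex1E) (metis (mono_tags, lifting) case_prod_conv)
  then show same: "K = K'" by simp
  show "D (i + h) = D' (j + h)"
  proof -
    from same have "D' \<in> curve_of D" using covering_member(2)[OF assms(1,2,4)] assms(5) by simp
    then obtain k where k: "D' = (\<lambda>i. D (i + k))" by (auto simp: mem_curve_of_iff)
    moreover have "inj (\<lambda>i. support (D i))"
      using covering_member(1)[OF assms(1,2,4)] by (simp add: complete_curve_def)
    ultimately have "i = j + k" using assms(6) by (auto dest: injD)
    then show "D (i + h) = D' (j + h)" by (simp add: k algebra_simps)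
  qed
qed

lemma covering_segment_exists:
  assumes "folding_covering \<C>" "is_segment c"
  obtains K D i where "K \<in> \<C>" "D \<in> K" "support (D i) = support c"
proof -
  have "support c \<in> unit_edges" using assms(2) by (auto simp: unit_edges_def)
  then obtain K d where "K \<in> \<C>" "d \<in> segments_of K" "support d = support c"
    using assms(1) unfolding folding_covering_def by (metis (mono_tags, lifting) case_prodE)
  then show ?thesis using that by (auto simp: segments_of_def)
qed

subsection \<open>Transfer by the local isomorphism property\<close>

definition decoration :: "(int \<Rightarrow> segment) \<Rightarrow> int \<Rightarrow> decorated_segment" where
  "decoration D i = (D i, support (D (i - 1)), support (D (i + 1)))"

lemma decoration_in_decorated_segments:
  "K \<in> \<C> \<Longrightarrow> D \<in> K \<Longrightarrow> decoration D i \<in> decorated_segments \<C>"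
  unfolding decoration_def decorated_segments_def by blast

lemma decorated_segmentE:
  assumes "d \<in> decorated_segments \<C>"
  obtains K D i where "K \<in> \<C>" "D \<in> K" "d = decoration D i"
  using assms unfolding decorated_segments_def decoration_def by blast

lemma translate_decoration:
  "translate v (decoration D i) =
    (shift v (D i), support (shift v (D (i - 1))), support (shift v (D (i + 1))))"
  by (simp add: translate_def decoration_def shift_def support_def split: prod.split)

lemma translate_decoration_eq:
  assumes "complete_curve C" "complete_curve D" "translate v (decoration D i) = decoration C j"
  shows "C j = shift v (D i)" "C (j + 1) = shift v (D (i + 1))"
proof -
  show j: "C j = shift v (D i)"
    using assms(3) unfolding translate_decoration by (simp add: decoration_def)
  have "fst (C (j + 1)) = fst (shift v (D (i + 1)))"
    using arg_cong[OF j, of snd] assms(1,2) by (simp add: complete_curve_def)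
  moreover have "support (C (j + 1)) = support (shift v (D (i + 1)))"
    using assms(3) unfolding translate_decoration by (simp add: decoration_def)
  ultimately show "C (j + 1) = shift v (D (i + 1))"
    by (auto simp: support_def doubleton_eq_iff prod_eq_iff)
qed

locale covered_plane = folding_plane \<alpha> \<epsilon> + placement origin unit
  for \<alpha> :: "nat \<Rightarrow> int" and \<epsilon> :: int and origin unit :: point +
  fixes C :: "int \<Rightarrow> segment" and \<C> :: "curve set"
  assumes toeplitz_turns: "toeplitz 0 (turns C)"
    and curve_C: "complete_curve C" and C_1: "C 1 = place east"
    and covering: "folding_covering \<C>" and C_mem: "curve_of C \<in> \<C>"
    and local_iso: "local_isomorphism \<C>"
begin

definition central_walk :: "int \<Rightarrow> segment" where
  "central_walk = inv place \<circ> C"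

lemma C_eq_place: "C h = place (central_walk h)"
  using bij_place by (simp add: central_walk_def bij_is_surj surj_f_inv_f)

lemma central_walk_1: "central_walk 1 = east"
  using C_1 C_eq_place[of 1] place_eq_iff by simp

lemma walk_central_walk: "walk (turns C) central_walk"
  unfolding central_walk_def by (rule walk_inv_place[OF curve_C east_west_arrows(3) C_1])

lemma snd_central_walk_0: "snd (central_walk 0) = 0"
  using walkD(4)[OF walk_central_walk, of 0] by (simp add: central_walk_1 zero_prod_def)

lemma trajectory_central_walk: "trajectory 0 central_walk"
proof -
  have "turn 0 (snd (central_walk h)) = turns C h" for h
    by (rule walk_through_center_turn[OF walk_central_walk snd_central_walk_0 toeplitz_turns]) simp
  then show ?thesis using walk_central_walk by (simp add: trajectory_iff_walk)
qed

lemma curve_C_contains_disk: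
  obtains z where
    "\<And>K D i. K \<in> \<C> \<Longrightarrow> D \<in> K \<Longrightarrow> edge_points (support (D i)) \<subseteq> cball z r \<Longrightarrow> K = curve_of C"
proof -
  obtain v where v: "\<And>e. is_arrow e \<Longrightarrow> sqnorm (fst e - v) \<le> \<lceil>r\<^sup>2\<rceil> \<Longrightarrow> same_curve 0 e east"
    using curve_of_east_contains_disk by blast
  have "K = curve_of C"
    if D: "K \<in> \<C>" "D \<in> K" "edge_points (support (D i)) \<subseteq> cball (real_point (embed v)) r" for K D i
  proof -
    have "is_segment (D i)"
      using covering_member(1)[OF covering D(1,2)] by (simp add: complete_curve_def)
    then obtain e where e: "is_arrow e" "support (place e) = support (D i)"
      by (rule arrow_with_support)
    have "embed (fst e) \<in> support (D i)" unfolding e(2)[symmetric] by (simp add: support_def)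
    then have "real_point (embed (fst e)) \<in> edge_points (support (D i))"
      unfolding edge_points_def by (intro hull_inc imageI)
    then have "dist (real_point (embed (fst e))) (real_point (embed v)) \<le> r"
      using D(3) by (auto simp: dist_commute)
    then have "real_of_int (sqnorm (fst e - v)) \<le> r\<^sup>2"
      unfolding dist_real_point by (simp add: embed_diff sqnorm_gmult sqnorm_unit sqrt_le_D)
    then have "same_curve 0 e (central_walk 1)"
      unfolding central_walk_1 using v[OF e(1)] by linarith
    then have "same_curve 0 (central_walk 1) e" by (rule equivclp_sym)
    then have "e \<in> range central_walk"
      by (simp only: same_curve_trajectory_iff[OF trajectory_central_walk])
    then obtain h where "e = central_walk h" by blast
    then have "support (D i) = support (C h)" using e(2) by (simp add: C_eq_place)
    then show ?thesis
      using covering_curves_meet(1)[OF covering D(1) C_mem D(2) curve_of_self] by blast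
  qed
  then show ?thesis using that by blast
qed

lemma translate_into_C:
  assumes "finite F" "F \<subseteq> decorated_segments \<C>"
  obtains v where "\<And>d. d \<in> F \<Longrightarrow> \<exists>j. translate v d = decoration C j"
proof -
  obtain r where r: "\<And>z. \<exists>v. translate v ` F \<subseteq> decorated_segments \<C> \<and>
      (\<Union>d\<in>translate v ` F. decorated_points d) \<subseteq> cball z r"
    using local_iso[unfolded local_isomorphism_def, rule_format, OF conjI[OF assms]] by metis
  obtain z where z:
    "\<And>K D i. K \<in> \<C> \<Longrightarrow> D \<in> K \<Longrightarrow> edge_points (support (D i)) \<subseteq> cball z r \<Longrightarrow> K = curve_of C"
    using curve_C_contains_disk by blast
  obtain v where v: "translate v ` F \<subseteq> decorated_segments \<C>"
    "(\<Union>d\<in>translate v ` F. decorated_points d) \<subseteq> cball z r" using r by blast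
  have "\<exists>j. translate v d = decoration C j" if d: "d \<in> F" for d
  proof -
    have "translate v d \<in> decorated_segments \<C>" using v(1) d by blast
    then obtain K D i where D: "K \<in> \<C>" "D \<in> K" "translate v d = decoration D i"
      by (rule decorated_segmentE)
    have "edge_points (support (D i)) \<subseteq> decorated_points (translate v d)"
      by (auto simp: D(3) decoration_def decorated_points_def)
    also have "\<dots> \<subseteq> cball z r" using v(2) d by blast
    finally have "D \<in> curve_of C" using z[OF D(1,2)] D(2) by blast
    then obtain k where "D = (\<lambda>i. C (i + k))" by (auto simp: mem_curve_of_iff)
    then have "translate v d = decoration C (i + k)"
      unfolding D(3) decoration_def by (simp add: algebra_simps)
    then show ?thesis by blast
  qed
  then show ?thesis using that by blast
qed

text \<open>A translation that maps a long piece of \<open>C\<close> into \<open>C\<close> belongs to the lattice of the \<open>k\<close>-th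
  derivative; translating a segment of another curve along with such a piece carries the turns of
  \<open>C\<close> over to that curve.\<close>

lemma translation_of_long_piece:
  assumes "\<And>h. 0 \<le> h \<Longrightarrow> h \<le> 8 * 2 ^ k \<Longrightarrow> \<exists>j. translate v (decoration C h) = decoration C j"
  obtains p where "v = unit \<odot> (multiplier 0 k \<odot> p)"
proof -
  obtain j where
    j: "\<And>h. 0 \<le> h \<Longrightarrow> h \<le> 8 * 2 ^ k \<Longrightarrow> translate v (decoration C h) = decoration C (j h)"
    using assms by metis
  have image: "C (j h) = shift v (C h)" "C (j h + 1) = shift v (C (h + 1))"
    if "0 \<le> h" "h \<le> 8 * 2 ^ k" for h
    using translate_decoration_eq[OF curve_C curve_C j[OF that]] by simp_all
  have consecutive: "j h = j 0 + h" if "0 \<le> h" "h \<le> 8 * 2 ^ k" for h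
    using that
  proof (induction h rule: int_ge_induct)
    case (step h)
    then have "C (j (h + 1)) = C (j h + 1)" using image(1)[of "h + 1"] image(2)[of h] by simp
    moreover have "inj (\<lambda>i. support (C i))" using curve_C by (simp add: complete_curve_def)
    ultimately have "j (h + 1) = j h + 1" by (metis injD)
    then show ?case using step by simp
  qed simp
  have "turns C (j 0 + h) = turns C h" if "0 \<le> h" "h \<le> 8 * 2 ^ k" for h
    using image[OF that] by (simp add: turns_def flip: consecutive[OF that])
  then have "2 ^ k dvd j 0" by (rule toeplitz_recognizable[OF toeplitz_turns])
  then obtain i where "j 0 = 2 ^ k * i" by (elim dvdE)
  then obtain p where p: "snd (central_walk (j 0)) = multiplier 0 k \<odot> p"
    using walk_through_center_multiplier[OF walk_central_walk snd_central_walk_0 toeplitz_turns]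
    by metis
  have "snd (C (j 0)) = v + snd (C 0)" using image(1)[of 0] by simp
  then have "embed (multiplier 0 k \<odot> p) = v + embed 0"
    by (simp add: C_eq_place snd_central_walk_0 p)
  then show ?thesis using that[of p] by (simp add: embed_def)
qed

lemma local_turn:
  assumes "K \<in> \<C>" "D \<in> K" "k \<ge> 1"
  obtains e p where "is_arrow e" "D i = place e"
    "D (i + 1) = place (turn_by (turn 0 (snd e + multiplier 0 k \<odot> p)) e)"
proof -
  define F where "F = insert (decoration D i) (decoration C ` {0..8 * 2 ^ k})"
  have "F \<subseteq> decorated_segments \<C>"
    using decoration_in_decorated_segments assms(1,2) C_mem curve_of_self by (auto simp: F_def)
  then obtain v where v: "\<And>d. d \<in> F \<Longrightarrow> \<exists>j. translate v d = decoration C j"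
    using translate_into_C[of F] by (auto simp: F_def)
  then have "\<exists>j. translate v (decoration C h) = decoration C j" if "0 \<le> h" "h \<le> 8 * 2 ^ k" for h
    using that by (simp add: F_def)
  then obtain p where p: "v = unit \<odot> (multiplier 0 k \<odot> p)" by (rule translation_of_long_piece)
  define u where "u = multiplier 0 k \<odot> p"
  obtain j where "translate v (decoration D i) = decoration C j"
    using v[of "decoration D i"] by (auto simp: F_def)
  from translate_decoration_eq[OF curve_C covering_member(1)[OF covering assms(1,2)] this]
  have j: "place (central_walk j) = shift (unit \<odot> u) (D i)"
    "place (central_walk (j + 1)) = shift (unit \<odot> u) (D (i + 1))"
    by (simp_all add: C_eq_place p u_def)
  have unshift: "d = place (shift (- u) f)" if "place f = shift (unit \<odot> u) d" for d f
    by (simp add: that prod_eq_iff gmult_minus_right flip: shift_place)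
  define e where "e = shift (- u) (central_walk j)"
  have "D i = place e" unfolding e_def by (rule unshift[OF j(1)])
  moreover have "D (i + 1) = place (turn_by (turn 0 (snd e + u)) e)"
    using unshift[OF j(2)] trajectoryD(2)[OF trajectory_central_walk, of j]
    by (simp add: e_def turn_by_shift successor_def)
  moreover have "is_arrow e"
    using trajectoryD(1)[OF trajectory_central_walk] assms(3)
    by (simp add: e_def is_arrow_shift u_def even_point_multiplier)
  ultimately show ?thesis using that by (simp add: u_def)
qed

lemma turn_at_center:
  assumes "K \<in> \<C>" "D \<in> K" "is_arrow e" "snd e = 0" "D i = place e"
    and turn: "D (i + 1) = place (turn_by t e)" "is_sign t"
  shows "D (i + 1) = place (turn_by \<epsilon> e)"
proof -
  note meet = covering_curves_meet(2)[OF covering assms(1) C_mem assms(2) curve_of_self]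
  have arrow_0: "is_arrow (central_walk 0)"
    and step_0: "central_walk 1 = turn_by \<epsilon> (central_walk 0)"
    using trajectoryD[OF trajectory_central_walk, of 0]
    by (simp_all add: successor_def snd_central_walk_0)
  show ?thesis
  proof (cases "e = central_walk 0")
    case True
    then have "D (i + 1) = C (0 + 1)" using meet[of i 0 1] assms(5) by (simp add: C_eq_place)
    then show ?thesis using True step_0 by (simp add: C_eq_place)
  next
    case False
    have "t = \<epsilon>"
    proof (rule ccontr)
      assume "t \<noteq> \<epsilon>"
      with turn(2) have "t = - \<epsilon>" using sign_center by (metis minus_minus)
      then have "turn_by t e = central_walk 1"
        using turn_by_opposite[OF assms(3) arrow_0 assms(4) snd_central_walk_0 False, of \<epsilon>] step_0
        by simp
      then have "D (i + 1) = C 1" using turn(1) by (simp add: C_eq_place)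
      then have "D (i + 1 + - 1) = C (1 + - 1)" by (intro meet) simp
      then show False using assms(5) False by (simp add: C_eq_place place_eq_iff)
    qed
    then show ?thesis using turn(1) by simp
  qed
qed

lemma curve_follows_successor:
  assumes "K \<in> \<C>" "D \<in> K"
  obtains e where "is_arrow e" "D i = place e" "D (i + 1) = place (successor 0 e)"
proof -
  obtain q where q: "snd (D i) = embed q" using bij_embed by (metis bij_pointE)
  have snd: "snd e = q" if "D i = place e" for e using q that by (simp add: embed_eq_iff)
  show ?thesis
  proof (cases "q = 0")
    case False
    then obtain k where k: "k \<ge> 1" "\<And>p. turn 0 (q + multiplier 0 k \<odot> p) = turn 0 q"
      using turn_periodic by blast
    obtain e p where "is_arrow e" "D i = place e"
      "D (i + 1) = place (turn_by (turn 0 (snd e + multiplier 0 k \<odot> p)) e)"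
      using local_turn[OF assms k(1)] by blast
    then show ?thesis using that k(2) snd by (simp add: successor_def)
  next
    case True
    obtain e p where e: "is_arrow e" "D i = place e"
      "D (i + 1) = place (turn_by (turn 0 (snd e + multiplier 0 1 \<odot> p)) e)"
      using local_turn[OF assms order_refl] by blast
    have "snd e = 0" using snd[OF e(2)] True by simp
    then have "D (i + 1) = place (successor 0 e)"
      using turn_at_center[OF assms e(1) _ e(2,3) is_sign_turn] by (simp add: successor_def)
    then show ?thesis using that e by blast
  qed
qed

lemma curve_trajectory:
  assumes "K \<in> \<C>" "D \<in> K"
  obtains u where "trajectory 0 u" "\<And>h. D h = place (u h)"
proof -
  have "\<exists>e. is_arrow e \<and> D h = place e \<and> D (h + 1) = place (successor 0 e)" for h
    using curve_follows_successor[OF assms] by metis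
  then obtain u where
    u: "\<And>h. is_arrow (u h) \<and> D h = place (u h) \<and> D (h + 1) = place (successor 0 (u h))"
    by metis
  then have "u (h + 1) = successor 0 (u h)" for h using place_eq_iff by metis
  then have "trajectory 0 u" using u by (simp add: trajectory_def)
  then show ?thesis using that u by blast
qed

subsection \<open>Counting the curves\<close>

definition curve_at :: "segment \<Rightarrow> curve" where
  "curve_at e = (THE K. K \<in> \<C> \<and> place e \<in> segments_of K)"

lemma curve_at_eqI:
  assumes "K \<in> \<C>" "D \<in> K" "D i = place e"
  shows "curve_at e = K"
  unfolding curve_at_def
proof (rule the_equality)
  have "D i \<in> segments_of K" using assms(2) by (auto simp: segments_of_def)
  with assms(1,3) show "K \<in> \<C> \<and> place e \<in> segments_of K" by simp
next
  fix K' assume "K' \<in> \<C> \<and> place e \<in> segments_of K'"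
  then obtain D' j where D': "K' \<in> \<C>" "D' \<in> K'" "D' j = place e" by (auto simp: segments_of_def)
  then show "K' = K"
    using covering_curves_meet(1)[OF covering D'(1) assms(1) D'(2) assms(2), of j i] assms(3)
    by simp
qed

lemma curve_through_arrow:
  assumes "is_arrow e"
  obtains K D i where "K \<in> \<C>" "D \<in> K" "D i = place e"
proof -
  have "is_segment (place e)" using assms by (simp add: is_segment_place is_arrow_imp_segment)
  then obtain K D i where D: "K \<in> \<C>" "D \<in> K" "support (D i) = support (place e)"
    using covering_segment_exists[OF covering] by metis
  obtain u where u: "trajectory 0 u" "\<And>h. D h = place (u h)"
    using curve_trajectory[OF D(1,2)] by metis
  then have "u i = e"
    using D(3) support_place_eq_iff[OF trajectoryD(1)[OF u(1)] assms] by simp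
  with D that u(2) show ?thesis by metis
qed

lemma curve_at_mem: "is_arrow e \<Longrightarrow> curve_at e \<in> \<C>"
  using curve_through_arrow curve_at_eqI by metis

lemma curve_at_eq_iff:
  assumes "is_arrow e" "is_arrow f"
  shows "curve_at e = curve_at f \<longleftrightarrow> same_curve 0 e f"
proof -
  obtain K D i where D: "K \<in> \<C>" "D \<in> K" "D i = place e" using curve_through_arrow[OF assms(1)] .
  obtain K' D' j where D': "K' \<in> \<C>" "D' \<in> K'" "D' j = place f"
    using curve_through_arrow[OF assms(2)] .
  obtain u where u: "trajectory 0 u" "\<And>h. D h = place (u h)"
    using curve_trajectory[OF D(1,2)] by metis
  have "u i = e" using u(2) D(3) place_eq_iff by metis
  then have same: "same_curve 0 e f \<longleftrightarrow> f \<in> range u"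
    using same_curve_trajectory_iff[OF u(1), of i f] by simp
  show ?thesis
  proof
    assume "curve_at e = curve_at f"
    then have "K = K'" using curve_at_eqI[OF D] curve_at_eqI[OF D'] by simp
    then have "D' \<in> curve_of D" using D'(2) covering_member(2)[OF covering D(1,2)] by simp
    then obtain k where "D' = (\<lambda>i. D (i + k))" by (auto simp: mem_curve_of_iff)
    then have "place f = place (u (j + k))" using D'(3) u(2) by simp
    then show "same_curve 0 e f" using same place_eq_iff by blast
  next
    assume "same_curve 0 e f"
    then obtain h where "f = u h" using same by blast
    then have "D h = place f" using u(2) by simp
    then show "curve_at e = curve_at f" using curve_at_eqI[OF D] curve_at_eqI[OF D(1,2)] by simp
  qed
qed

lemma curve_eq_curve_at:
  assumes "K \<in> \<C>"
  obtains e where "is_arrow e" "K = curve_at e"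
proof -
  obtain D where D: "D \<in> K" using covering_curve_nonempty[OF covering assms] .
  obtain u where u: "trajectory 0 u" "\<And>h. D h = place (u h)"
    using curve_trajectory[OF assms D] by metis
  show ?thesis
    using that[of "u 0"] curve_at_eqI[OF assms D u(2)[of 0]] trajectoryD(1)[OF u(1)] by simp
qed

lemma turns_trajectory:
  assumes "trajectory 0 u" "\<And>h. D h = place (u h)"
  shows "turns D = (\<lambda>h. turn 0 (snd (u h)))"
proof (intro ext turns_eqI)
  show "D (h + 1) = turn_by (turn 0 (snd (u h))) (D h)" for h
    using assms(2) trajectoryD(2)[OF assms(1)] by (simp add: successor_def turn_by_place)
  show "is_segment (D h)" for h
    using assms(2) trajectoryD(1)[OF assms(1)] by (simp add: is_segment_place is_arrow_imp_segment)
qed simp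

lemma turns_through_center_iff:
  assumes "trajectory 0 u" "\<And>h. D h = place (u h)"
  shows "turns D = turns C \<longleftrightarrow> snd (u 0) = 0"
proof
  have walk: "walk (turns D) u"
    using assms(1) by (simp add: trajectory_iff_walk turns_trajectory[OF assms])
  show "snd (u 0) = 0" if "turns D = turns C"
  proof (rule walk_through_center_if_toeplitz[OF walk])
    show "toeplitz 0 (turns D)" unfolding that by (rule toeplitz_turns)
    show "turn 0 (snd (u h)) = turns D h" for h by (simp add: turns_trajectory[OF assms])
  qed
  assume "snd (u 0) = 0"
  then have "turn 0 (snd (u h)) = turns C h" for h
    by (rule walk_through_center_turn[OF walk _ toeplitz_turns])
      (simp add: turns_trajectory[OF assms])
  then show "turns D = turns C" by (simp add: turns_trajectory[OF assms])
qed

lemma curves_with_assoc_seq: "{K \<in> \<C>. has_assoc_seq K (turns C)} = {curve_at east, curve_at west}"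
proof (intro equalityI subsetI)
  fix K assume "K \<in> {K \<in> \<C>. has_assoc_seq K (turns C)}"
  then obtain D where D: "K \<in> \<C>" "D \<in> K" "turns D = turns C" by (auto simp: has_assoc_seq_def)
  obtain u where u: "trajectory 0 u" "\<And>h. D h = place (u h)"
    using curve_trajectory[OF D(1,2)] by metis
  have "fst (u 1) = 0"
    using turns_through_center_iff[OF u] D(3) trajectoryD(2)[OF u(1), of 0] by simp
  moreover have "is_arrow (u 1)" by (rule trajectoryD(1)[OF u(1)])
  ultimately have "u 1 \<in> {east, west}"
    using center_arrows_iff[of "u 1"] by (auto simp: center_arrows_def zero_prod_def)
  then show "K \<in> {curve_at east, curve_at west}" using curve_at_eqI[OF D(1,2) u(2)[of 1]] by auto
next
  fix K assume "K \<in> {curve_at east, curve_at west}"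
  then consider "K = curve_at east" | "K = curve_at west" by blast
  then obtain e where e: "is_arrow e" "fst e = 0" "K = curve_at e"
    by cases (use that[of east] that[of west] in \<open>auto simp: zero_prod_def\<close>)
  obtain K' D' i where D': "K' \<in> \<C>" "D' \<in> K'" "D' i = place e" using curve_through_arrow[OF e(1)] .
  then have "K' = K" using curve_at_eqI e(3) by simp
  define D where "D = (\<lambda>h. D' (h + (i - 1)))"
  have "D \<in> K"
    using covering_member(2)[OF covering D'(1,2)] \<open>K' = K\<close> by (auto simp: D_def mem_curve_of_iff)
  have "K \<in> \<C>" using D'(1) \<open>K' = K\<close> by simp
  obtain u where u: "trajectory 0 u" "\<And>h. D h = place (u h)"
    using curve_trajectory[OF \<open>K \<in> \<C>\<close> \<open>D \<in> K\<close>] by metis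
  have "u 1 = e" using u(2)[of 1] D'(3) by (simp add: D_def place_eq_iff)
  then have "snd (u 0) = 0" using trajectoryD(2)[OF u(1), of 0] e(2) by simp
  then have "turns D = turns C" using turns_through_center_iff[OF u] by simp
  with \<open>D \<in> K\<close> \<open>K \<in> \<C>\<close> show "K \<in> {K \<in> \<C>. has_assoc_seq K (turns C)}"
    by (auto simp: has_assoc_seq_def)
qed

lemma card_curves_with_assoc_seq: "card {K \<in> \<C>. has_assoc_seq K (turns C)} = 2"
  unfolding curves_with_assoc_seq using curve_at_eq_iff not_same_curve_east_west by simp

lemma has_assoc_seq_iff:
  assumes "is_arrow e"
  shows "has_assoc_seq (curve_at e) (turns C) \<longleftrightarrow> same_curve 0 e east \<or> same_curve 0 e west"
proof -
  have "has_assoc_seq (curve_at e) (turns C) \<longleftrightarrow> curve_at e \<in> {curve_at east, curve_at west}"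
    unfolding curves_with_assoc_seq[symmetric] using curve_at_mem[OF assms] by simp
  then show ?thesis by (simp add: curve_at_eq_iff assms)
qed

lemma other_curves_alternating:
  assumes alt: "alternating_from n"
    and r: "\<And>f. f \<in> survivors (\<alpha> n) \<Longrightarrow> is_arrow (r f) \<and> ancestor 0 n (r f) = f"
  shows "{K \<in> \<C>. \<not> has_assoc_seq K (turns C)} = (\<lambda>f. curve_at (r f)) ` survivors (\<alpha> n)"
proof (intro equalityI subsetI)
  fix K assume K: "K \<in> {K \<in> \<C>. \<not> has_assoc_seq K (turns C)}"
  then obtain e where e: "is_arrow e" "K = curve_at e" using curve_eq_curve_at by blast
  from alt e(1) show "K \<in> (\<lambda>f. curve_at (r f)) ` survivors (\<alpha> n)"
  proof (cases rule: same_curve_survivor_cases)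
    case (survivor f)
    then have "K = curve_at (r f)" using e r curve_at_eq_iff[of e "r f"] by simp
    with survivor(1) show ?thesis by blast
  qed (use K e has_assoc_seq_iff in simp_all)
next
  fix K assume "K \<in> (\<lambda>f. curve_at (r f)) ` survivors (\<alpha> n)"
  then obtain f where f: "f \<in> survivors (\<alpha> n)" "K = curve_at (r f)" by blast
  then have "\<not> has_assoc_seq K (turns C)"
    using not_same_curve_survivor_center[OF alt, of "r f"] r[OF f(1)] has_assoc_seq_iff[of "r f"]
    by simp
  then show "K \<in> {K \<in> \<C>. \<not> has_assoc_seq K (turns C)}"
    using f(2) r[OF f(1)] curve_at_mem[of "r f"] by simp
qed

lemma card_other_curves_alternating:
  assumes alt: "alternating_from n"
  shows "card {K \<in> \<C>. \<not> has_assoc_seq K (turns C)} = 4"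
proof -
  have "\<forall>f\<in>survivors (\<alpha> n). \<exists>e. is_arrow e \<and> ancestor 0 n e = f"
  proof
    fix f assume "f \<in> survivors (\<alpha> n)"
    then have "is_arrow f" using survivors_subset is_arrow_square by blast
    then show "\<exists>e. is_arrow e \<and> ancestor 0 n e = f" by (rule ancestor_surj) blast
  qed
  from bchoice[OF this] obtain r
    where r: "\<And>f. f \<in> survivors (\<alpha> n) \<Longrightarrow> is_arrow (r f) \<and> ancestor 0 n (r f) = f" by blast
  have "inj_on (\<lambda>f. curve_at (r f)) (survivors (\<alpha> n))"
  proof (rule inj_onI)
    fix f g assume "f \<in> survivors (\<alpha> n)" "g \<in> survivors (\<alpha> n)" "curve_at (r f) = curve_at (r g)"
    then show "f = g"
      using curve_at_eq_iff[of "r f" "r g"] same_curve_survivors_iff[OF alt, of "r f" "r g"]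
        r[of f] r[of g] by simp
  qed
  then show ?thesis
    by (simp add: other_curves_alternating[OF alt r] card_image card_survivors)
qed

lemma all_curves_with_assoc_seq_if_never_alternating:
  assumes "\<And>n. \<not> alternating_from n" "K \<in> \<C>"
  shows "has_assoc_seq K (turns C)"
proof -
  obtain e where e: "is_arrow e" "K = curve_at e" using curve_eq_curve_at[OF assms(2)] .
  then show ?thesis
    using same_curve_if_never_alternating[OF assms(1) e(1)] by (simp add: has_assoc_seq_iff)
qed

end

theorem theorem3p15:
  fixes a :: "nat \<Rightarrow> int" and \<epsilon> :: int and C :: "int \<Rightarrow> segment" and \<C> :: "curve set"
  assumes "infinite_folding_seq a"
    and "\<epsilon> \<in> {1, -1}"
    and "complete_curve C"
    and "turns C = two_sided a \<epsilon>"
    and "folding_covering \<C>"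
    and "curve_of C \<in> \<C>"
    and "local_isomorphism \<C>"
  shows "(finite {n::nat. a (2 ^ n) = (-1) ^ n} \<or> finite (- {n::nat. a (2 ^ n) = (-1) ^ n}) \<longrightarrow>
            card {K \<in> \<C>. has_assoc_seq K (two_sided a \<epsilon>)} = 2 \<and>
            card {K \<in> \<C>. \<not> has_assoc_seq K (two_sided a \<epsilon>)} = 4) \<and>
         (\<not> (finite {n::nat. a (2 ^ n) = (-1) ^ n} \<or> finite (- {n::nat. a (2 ^ n) = (-1) ^ n})) \<longrightarrow>
            card \<C> = 2 \<and> (\<forall>K\<in>\<C>. has_assoc_seq K (two_sided a \<epsilon>)))"
proof -
  have \<epsilon>: "is_sign \<epsilon>" using assms(2) by simp
  interpret folding_plane "\<lambda>n. a (2 ^ n)" \<epsilon>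
    using assms(1) \<epsilon> by (rule folding_plane_infinite_folding_seq)
  have "is_segment (C 1)" using assms(3) by (simp add: complete_curve_def)
  then obtain origin unit where "placement unit" and C_1: "C 1 = placement.place origin unit east"
    by (rule placement_of_segment)
  then interpret placement origin unit by simp
  interpret covered_plane "\<lambda>n. a (2 ^ n)" \<epsilon> origin unit C \<C>
    using toeplitz_two_sided[OF assms(1) \<epsilon>] assms(3-7) C_1 by unfold_locales simp_all
  have alternating: "finite {n. a (2 ^ n) = (-1) ^ n} \<or> finite (- {n. a (2 ^ n) = (-1) ^ n})
      \<longleftrightarrow> (\<exists>n. alternating_from n)"
    using eventually_alternating_iff[of "\<lambda>n. a (2 ^ n)"] sign_letter
    by (simp add: alternating_from_def)
  show ?thesis
    unfolding alternating assms(4)[symmetric]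
  proof (intro conjI impI)
    assume "\<exists>n. alternating_from n"
    then show "card {K \<in> \<C>. \<not> has_assoc_seq K (turns C)} = 4"
      using card_other_curves_alternating by blast
  next
    assume "\<not> (\<exists>n. alternating_from n)"
    then show "\<forall>K\<in>\<C>. has_assoc_seq K (turns C)"
      using all_curves_with_assoc_seq_if_never_alternating by blast
    then have "{K \<in> \<C>. has_assoc_seq K (turns C)} = \<C>" by blast
    then show "card \<C> = 2" using card_curves_with_assoc_seq by simp
  qed (rule card_curves_with_assoc_seq)
qed

end
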